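(* For every integer $d\geq 3$ there is a constant $C_d>0$ such that for all positive integers $n$, $$\mathrm{ex}(n,Q_d)\leq C_d\, n^{2-\frac{1}{d-1}+\frac{1}{(d-1)2^{d-1}}}.$$
   Context: For a graph $H$ and a positive integer $n$, $\mathrm{ex}(n,H)$ denotes the maximum number of edges in an $n$-vertex graph containing no subgraph isomorphic to $H$. The $d$-dimensional hypercube $Q_d$ is the graph with vertex set $\{0,1\}^d$ in which two vertices are adjacent if and only if they differ in exactly one coordinate. *)

theory Defs
  imports Complex_Main "HOL-Library.FuncSet" "HOL-Library.Ramsey"
begin

type_synonym 'a graph = "'a set \<times> 'a set set"

abbreviation verts :: "'a graph \<Rightarrow> 'a set" where "verts \<equiv> fst"
abbreviation edges :: "'a graph \<Rightarrow> 'a set set" where "edges \<equiv> snd"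

definition simple_graph :: "'a graph \<Rightarrow> bool" where
  "simple_graph G \<longleftrightarrow> edges G \<subseteq> nsets (verts G) 2"

definition subgraph :: "'a graph \<Rightarrow> 'a graph \<Rightarrow> bool" where
  "subgraph K G \<longleftrightarrow> simple_graph K \<and> verts K \<subseteq> verts G \<and> edges K \<subseteq> edges G"

definition graph_isomorphic :: "'a graph \<Rightarrow> 'b graph \<Rightarrow> bool" where
  "graph_isomorphic G H \<longleftrightarrow>
     (\<exists>f. bij_betw f (verts G) (verts H) \<and>
          (\<forall>u\<in>verts G. \<forall>v\<in>verts G. {u, v} \<in> edges G \<longleftrightarrow> {f u, f v} \<in> edges H))"

definition contains_copy :: "'a graph \<Rightarrow> 'b graph \<Rightarrow> bool" where
  "contains_copy G H \<longleftrightarrow> (\<exists>K. subgraph K G \<and> graph_isomorphic K H)"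

text \<open>
  The maximum is taken over graphs with vertex set \<open>{..<n}\<close>. This is no restriction, see
  \<open>card_edges_le_extremal_number\<close> below. It is a genuine (attained) maximum whenever \<open>H\<close> has
  an edge, see \<open>extremal_number_attained\<close>; for edgeless \<open>H\<close> there may be no \<open>H\<close>-free graph at
  all, and then the value is unspecified.
\<close>
definition extremal_number :: "nat \<Rightarrow> 'b graph \<Rightarrow> nat" where
  "extremal_number n H =
     Max {card (edges G) | G :: nat graph.
            simple_graph G \<and> verts G = {..<n} \<and> \<not> contains_copy G H}"

definition hypercube :: "nat \<Rightarrow> (nat \<Rightarrow> nat) graph" where
  "hypercube d =
     (let V = {..<d} \<rightarrow>\<^sub>E {0, 1}
      in (V, {{x, y} | x y. x \<in> V \<and> y \<in> V \<and> card {i \<in> {..<d}. x i \<noteq> y i} = 1}))"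

lemma simple_graph_edgeE:
  assumes "simple_graph G" "e \<in> edges G"
  obtains u v where "e = {u, v}" "u \<noteq> v" "u \<in> verts G" "v \<in> verts G"
proof -
  have "e \<subseteq> verts G" "card e = 2"
    using assms by (auto simp: simple_graph_def nsets_def)
  then show ?thesis
    using that by (auto simp: card_2_iff)
qed

lemma simple_graph_hypercube: "simple_graph (hypercube d)"
proof -
  have "{x, y} \<in> nsets ({..<d} \<rightarrow>\<^sub>E {0, 1}) 2"
    if "x \<in> {..<d} \<rightarrow>\<^sub>E {0, 1 :: nat}" "y \<in> {..<d} \<rightarrow>\<^sub>E {0, 1}"
       "card {i \<in> {..<d}. x i \<noteq> y i} = 1" for x y :: "nat \<Rightarrow> nat"
  proof -
    have "x \<noteq> y" using that(3) by auto
    then show ?thesis using that(1,2) unfolding nsets_def by simp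
  qed
  then show ?thesis
    unfolding simple_graph_def hypercube_def Let_def fst_conv snd_conv by blast
qed

lemma hypercube_has_edge:
  assumes "d > 0"
  shows "edges (hypercube d) \<noteq> {}"
proof -
  define x y :: "nat \<Rightarrow> nat"
    where "x = (\<lambda>i\<in>{..<d}. 0)" and "y = (\<lambda>i\<in>{..<d}. if i = 0 then 1 else 0)"
  have "{i \<in> {..<d}. x i \<noteq> y i} = {0}"
    using assms by (auto simp: x_def y_def)
  then have "card {i \<in> {..<d}. x i \<noteq> y i} = 1" by simp
  moreover have "x \<in> {..<d} \<rightarrow>\<^sub>E {0, 1}" "y \<in> {..<d} \<rightarrow>\<^sub>E {0, 1}"
    by (auto simp: x_def y_def)
  ultimately have "{x, y} \<in> edges (hypercube d)"
    unfolding hypercube_def Let_def snd_conv by blast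
  then show ?thesis by blast
qed

lemma contains_copy_iff:
  assumes "simple_graph H"
  shows "contains_copy G H \<longleftrightarrow>
    (\<exists>f. inj_on f (verts H) \<and> f ` verts H \<subseteq> verts G \<and> (\<forall>e\<in>edges H. f ` e \<in> edges G))"
    (is "_ \<longleftrightarrow> (\<exists>f. ?emb f)")
proof
  assume "contains_copy G H"
  then obtain K f where K: "subgraph K G" and f: "bij_betw f (verts K) (verts H)"
    and ed: "\<And>u v. \<lbrakk>u \<in> verts K; v \<in> verts K\<rbrakk> \<Longrightarrow> {u, v} \<in> edges K \<longleftrightarrow> {f u, f v} \<in> edges H"
    by (auto simp: contains_copy_def graph_isomorphic_def)
  define g where "g = inv_into (verts K) f"
  have g: "bij_betw g (verts H) (verts K)"
    unfolding g_def using f by (rule bij_betw_inv_into)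
  have "g ` e \<in> edges G" if e: "e \<in> edges H" for e
  proof -
    obtain u v where uv: "e = {u, v}" "u \<in> verts H" "v \<in> verts H"
      using simple_graph_edgeE[OF assms e] by metis
    have "f (g u) = u" "f (g v) = v" "g u \<in> verts K" "g v \<in> verts K"
      using uv f g bij_betw_inv_into_right[OF f] by (auto simp: g_def bij_betw_def)
    then have "{g u, g v} \<in> edges K" using ed uv e by simp
    then show ?thesis using K uv by (auto simp: subgraph_def)
  qed
  then have "?emb g"
    using g K by (auto simp: bij_betw_def subgraph_def)
  then show "\<exists>f. ?emb f" by (intro exI[of _ g])
next
  assume "\<exists>f. ?emb f"
  then obtain f where f: "inj_on f (verts H)" "f ` verts H \<subseteq> verts G"
    "\<forall>e\<in>edges H. f ` e \<in> edges G" by blast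
  define K where "K = (f ` verts H, (\<lambda>e. f ` e) ` edges H)"
  define g where "g = inv_into (verts H) f"
  have gf: "g (f u) = u" if "u \<in> verts H" for u
    using that f(1) by (simp add: g_def)
  have sub: "e \<subseteq> verts H" if "e \<in> edges H" for e
    using that assms by (auto simp: simple_graph_def nsets_def)
  have "simple_graph K"
    unfolding simple_graph_def K_def fst_conv snd_conv
  proof (rule image_subsetI)
    fix e assume e: "e \<in> edges H"
    obtain u v where uv: "e = {u, v}" "u \<noteq> v" "u \<in> verts H" "v \<in> verts H"
      using simple_graph_edgeE[OF assms e] by metis
    then have "f u \<noteq> f v" using f(1) by (auto dest: inj_onD)
    then show "f ` e \<in> nsets (f ` verts H) 2"
      using uv by (simp add: nsets_def)
  qed
  then have "subgraph K G"
    using f by (auto simp: subgraph_def K_def)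
  moreover have "bij_betw g (verts K) (verts H)"
    using f(1) by (simp add: g_def K_def bij_betw_inv_into inj_on_imp_bij_betw)
  moreover have "{f u, f v} \<in> edges K \<longleftrightarrow> {u, v} \<in> edges H"
    if "u \<in> verts H" "v \<in> verts H" for u v
  proof
    assume "{f u, f v} \<in> edges K"
    then obtain e where e: "e \<in> edges H" "f ` e = f ` {u, v}" by (auto simp: K_def)
    then have "e = {u, v}"
      using that sub f(1) by (metis inj_on_image_eq_iff insert_subset empty_subsetI)
    then show "{u, v} \<in> edges H" using e by simp
  next
    assume "{u, v} \<in> edges H"
    then have "f ` {u, v} \<in> edges K" unfolding K_def snd_conv by (rule imageI)
    then show "{f u, f v} \<in> edges K" by simp
  qed
  ultimately show "contains_copy G H"
    unfolding contains_copy_def graph_isomorphic_def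
    by (intro exI[of _ K] conjI exI[of _ g]) (auto simp: K_def gf)
qed

lemma finite_extremal_candidates:
  "finite {card (edges G) | G :: nat graph.
     simple_graph G \<and> verts G = {..<n} \<and> \<not> contains_copy G H}" (is "finite ?S")
proof (rule finite_subset)
  show "?S \<subseteq> card ` Pow (Pow {..<n})"
    by (auto simp: simple_graph_def nsets_def image_iff)
qed simp

lemma card_edges_le_extremal_number:
  fixes G :: "'a graph"
  assumes G: "simple_graph G" "finite (verts G)" "card (verts G) = n"
    and H: "simple_graph H" and free: "\<not> contains_copy G H"
  shows "card (edges G) \<le> extremal_number n H"
proof -
  obtain f where f: "bij_betw f (verts G) {..<n}"
    using ex_bij_betw_finite_nat[OF G(2)] G(3) by (auto simp: atLeast0LessThan)
  have sub: "e \<subseteq> verts G" if "e \<in> edges G" for e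
    using that G by (auto simp: simple_graph_def nsets_def)
  define G' :: "nat graph" where "G' = ({..<n}, (\<lambda>e. f ` e) ` edges G)"
  have inj: "inj_on (\<lambda>e. f ` e) (edges G)"
    using f sub by (intro inj_onI) (metis bij_betw_def inj_on_image_eq_iff)
  have "simple_graph G'"
    unfolding simple_graph_def G'_def fst_conv snd_conv
  proof (rule image_subsetI)
    fix e assume e: "e \<in> edges G"
    obtain u v where uv: "e = {u, v}" "u \<noteq> v" "u \<in> verts G" "v \<in> verts G"
      using simple_graph_edgeE[OF G(1) e] by metis
    then have "f u \<noteq> f v" "f u < n" "f v < n" using f by (auto simp: bij_betw_def dest: inj_onD)
    then show "f ` e \<in> nsets {..<n} 2"
      using uv by (simp add: nsets_def)
  qed
  moreover have "\<not> contains_copy G' H"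
  proof
    assume "contains_copy G' H"
    then obtain h where h: "inj_on h (verts H)" "h ` verts H \<subseteq> {..<n}"
      "\<And>e. e \<in> edges H \<Longrightarrow> h ` e \<in> (\<lambda>e. f ` e) ` edges G"
      unfolding contains_copy_iff[OF H] by (auto simp: G'_def)
    define g where "g = inv_into (verts G) f"
    have g: "bij_betw g {..<n} (verts G)"
      unfolding g_def using f by (rule bij_betw_inv_into)
    have "(g \<circ> h) ` e \<in> edges G" if e: "e \<in> edges H" for e
    proof -
      obtain e' where e': "e' \<in> edges G" "h ` e = f ` e'" using h(3)[OF e] by blast
      have "g ` (f ` e') = e'"
        using f sub[OF e'(1)] unfolding g_def
        by (simp add: bij_betw_def inv_into_image_cancel)
      then show ?thesis using e' by (simp only: image_comp [symmetric])
    qed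
    moreover have "inj_on (g \<circ> h) (verts H)"
      using h g by (meson bij_betw_def comp_inj_on inj_on_subset)
    moreover have "(g \<circ> h) ` verts H \<subseteq> verts G"
      using h(2) g by (auto simp: bij_betw_def)
    ultimately show False
      using free unfolding contains_copy_iff[OF H] by blast
  qed
  ultimately have "card (edges G') \<le> extremal_number n H"
    unfolding extremal_number_def
    by (intro Max_ge finite_extremal_candidates) (auto simp: G'_def)
  then show ?thesis
    using card_image[OF inj] by (simp add: G'_def)
qed

lemma extremal_number_attained:
  assumes H: "simple_graph H" "edges H \<noteq> {}"
  obtains G :: "nat graph" where "simple_graph G" "verts G = {..<n}" "\<not> contains_copy G H"
    "card (edges G) = extremal_number n H"
proof -
  let ?S = "{card (edges G) | G :: nat graph.
     simple_graph G \<and> verts G = {..<n} \<and> \<not> contains_copy G H}"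
  have "simple_graph ({..<n}, {})" "\<not> contains_copy ({..<n}, {}) H"
    unfolding contains_copy_iff[OF H(1)] using H(2) by (auto simp: simple_graph_def)
  then have "card (edges ({..<n}, {})) \<in> ?S"
    unfolding mem_Collect_eq by (intro exI[of _ "({..<n}, {})"] conjI) simp_all
  then have "Max ?S \<in> ?S"
    by (intro Max_in finite_extremal_candidates) blast
  then show ?thesis
    using that unfolding extremal_number_def by force
qed

end

(*
  Count homomorphisms of Q_d into a graph by Cauchy-Schwarz. Every reflection x_i <-> x_j or
  x_i <-> 1 - x_j of the cube fixes a vertex cut, so folding along it bounds the number of
  homomorphisms that identify two given vertices. Iterated foldings spread one coincidence over
  the whole even half of the cube; such a collapsed homomorphism is a star with 2^(d-1) leaves.
  Hence a graph with m vertices, maximum degree D and no copy of Q_d has only O(m D^(2^(d-1)))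
  homomorphisms from Q_d. The opposite estimate is the Sidorenko property of Q_d, by induction via
  Q_(d+1) = Q_d x K_2. The maximum degree is controlled by passing to a vertex subset U maximising
  e(U) / |U|^s, with s the exponent of the theorem, where high-degree vertices meet few edges.
*)
theory Submission
  imports Defs
begin

text \<open>The exponent is where the two counts balance. With N = 2^(d-1), m vertices, e arcs and
  maximum degree of order e/m, the Sidorenko bound gives at least e^(d N) / m^(2 (d-1) N)
  homomorphisms, and the star count gives at most a constant times m (e/m)^N. Hence e^((d-1) N) is
  at most a constant times m^(2 (d-1) N + 1 - N), and the root of order (d-1) N yields s. A few
  vertices of degree far above e/m would spoil the balance, so they have to be removed first.
  Without a copy of the cube no homomorphism is injective, so some pair of cube vertices is
  identified by a share of at least 4^(-d) of all h homomorphisms. A folding squares a count and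
  pays with a factor h. A chain of foldings therefore bounds the q-th power of the count for the
  pair by h^(q-1) times the count for the even half, and a constant share for the pair becomes a
  constant share for the even half. Two foldings for each coordinate beyond the first two give q =
  4^(d-2), hence the factor (4^d)^q.\<close>

section \<open>Cauchy-Schwarz for fibre products\<close>

lemma card_fibre_product:
  assumes "finite A" "finite B" "finite K" "f ` A \<subseteq> K"
  shows "card {(a, b) \<in> A \<times> B. f a = g b} = (\<Sum>k\<in>K. card {a\<in>A. f a = k} * card {b\<in>B. g b = k})"
proof -
  have "{(a, b) \<in> A \<times> B. f a = g b} = (\<Union>k\<in>K. {a\<in>A. f a = k} \<times> {b\<in>B. g b = k})"
    using assms(4) by auto
  also have "card \<dots> = (\<Sum>k\<in>K. card ({a\<in>A. f a = k} \<times> {b\<in>B. g b = k}))"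
    using assms by (intro card_UN_disjoint) auto
  finally show ?thesis by (simp add: card_cartesian_product)
qed

text \<open>Lagrange's identity: the difference of the two sides is half the double sum of the
  squares of \<open>a k * b l - a l * b k\<close>.\<close>

lemma Cauchy_Schwarz_sum:
  fixes a b :: "'k \<Rightarrow> real"
  shows "(\<Sum>k\<in>K. a k * b k)\<^sup>2 \<le> (\<Sum>k\<in>K. (a k)\<^sup>2) * (\<Sum>k\<in>K. (b k)\<^sup>2)"
proof -
  have "0 \<le> (\<Sum>k\<in>K. \<Sum>l\<in>K. (a k * b l - a l * b k)\<^sup>2)"
    by (intro sum_nonneg) simp
  also have "\<dots> = (\<Sum>k\<in>K. \<Sum>l\<in>K. (a k)\<^sup>2 * (b l)\<^sup>2) + (\<Sum>k\<in>K. \<Sum>l\<in>K. (b k)\<^sup>2 * (a l)\<^sup>2)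
      - 2 * (\<Sum>k\<in>K. \<Sum>l\<in>K. (a k * b k) * (a l * b l))"
    by (simp add: sum.distrib sum_subtractf sum_distrib_left power2_diff power_mult_distrib algebra_simps)
  also have "\<dots> = 2 * ((\<Sum>k\<in>K. (a k)\<^sup>2) * (\<Sum>k\<in>K. (b k)\<^sup>2) - (\<Sum>k\<in>K. a k * b k)\<^sup>2)"
    unfolding sum_product [symmetric] by (simp add: power2_eq_square algebra_simps)
  finally show ?thesis by simp
qed

lemma Cauchy_Schwarz_sum_nat:
  fixes a b :: "'k \<Rightarrow> nat"
  shows "(\<Sum>k\<in>K. a k * b k)\<^sup>2 \<le> (\<Sum>k\<in>K. (a k)\<^sup>2) * (\<Sum>k\<in>K. (b k)\<^sup>2)"
proof -
  have "real ((\<Sum>k\<in>K. a k * b k)\<^sup>2) \<le> real ((\<Sum>k\<in>K. (a k)\<^sup>2) * (\<Sum>k\<in>K. (b k)\<^sup>2))"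
    using Cauchy_Schwarz_sum[of "\<lambda>k. real (a k)" "\<lambda>k. real (b k)" K] by simp
  then show ?thesis by (simp only: of_nat_le_iff)
qed

text \<open>The form used for folding: \<open>f\<close> and \<open>g\<close> record what the two
  halves of a homomorphism share, and each half gets paired with a second half of its own
  kind.\<close>

lemma card_fibre_product_le:
  assumes "finite A" "finite B"
  shows "(card {(a, b) \<in> A \<times> B. f a = g b})\<^sup>2
    \<le> card {(a, a') \<in> A \<times> A. f a = f a'} * card {(b, b') \<in> B \<times> B. g b = g b'}"
proof -
  define K where "K = f ` A \<union> g ` B"
  have K: "finite K" "f ` A \<subseteq> K" "g ` B \<subseteq> K" using assms by (auto simp: K_def)
  show ?thesis
    unfolding card_fibre_product[OF assms K(1,2)] card_fibre_product[OF assms(1,1) K(1,2)]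
      card_fibre_product[OF assms(2,2) K(1,3)]
    using Cauchy_Schwarz_sum_nat by (simp add: power2_eq_square)
qed

section \<open>Foldings of the cube\<close>

text \<open>A vertex of the cube is encoded as the set of coordinates at which it is 1.\<close>

definition cube_adj :: "nat set \<Rightarrow> nat set \<Rightarrow> bool" where
  "cube_adj A B \<longleftrightarrow> (\<exists>k. sym_diff A B = {k})"

text \<open>The set \<open>S\<close> prescribes a coincidence, and \<open>S = {}\<close> prescribes
  none. Maps are extensional, so that they are determined by their values on the cube and can be
  counted.\<close>

definition cube_homs :: "nat \<Rightarrow> 'a set \<Rightarrow> ('a \<Rightarrow> 'a \<Rightarrow> bool) \<Rightarrow> nat set set \<Rightarrow> (nat set \<Rightarrow> 'a) set" where
  "cube_homs d V R S = {f \<in> Pow {..<d} \<rightarrow>\<^sub>E V.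
     (\<forall>A\<in>Pow {..<d}. \<forall>B\<in>Pow {..<d}. cube_adj A B \<longrightarrow> R (f A) (f B)) \<and> (\<forall>A\<in>S. \<forall>B\<in>S. f A = f B)}"

text \<open>
  The reflection swaps the coordinates \<open>i\<close> and \<open>j\<close> if \<open>b\<close> holds, and is \<open>x\<^sub>i \<leftrightarrow> 1 - x\<^sub>j\<close> otherwise.
  Its fixed vertices belong to both sides.
\<close>

definition moved :: "nat \<Rightarrow> nat \<Rightarrow> bool \<Rightarrow> nat set \<Rightarrow> bool" where
  "moved i j b A \<longleftrightarrow> ((i \<in> A) \<noteq> (j \<in> A)) = b"

text \<open>One formula serves both reflections: a vertex moved by the swap has exactly one of the
  two coordinates equal to 1, a vertex moved by the other reflection has both or neither, and in
  each case both coordinates get flipped.\<close>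

definition reflect :: "nat \<Rightarrow> nat \<Rightarrow> bool \<Rightarrow> nat set \<Rightarrow> nat set" where
  "reflect i j b A = (if moved i j b A then sym_diff A {i, j} else A)"

definition side :: "nat \<Rightarrow> nat \<Rightarrow> bool \<Rightarrow> bool \<Rightarrow> nat set set" where
  "side i j b c = {A. moved i j b A \<longrightarrow> (i \<in> A) = c}"

lemma finite_cube_homs [simp]: "finite V \<Longrightarrow> finite (cube_homs d V R S)"
  by (rule finite_subset[of _ "Pow {..<d} \<rightarrow>\<^sub>E V"]) (simp_all add: cube_homs_def finite_PiE)

lemma cube_homs_antimono: "S \<subseteq> S' \<Longrightarrow> cube_homs d V R S' \<subseteq> cube_homs d V R S"
  unfolding cube_homs_def by blast

lemma cube_homsD:
  assumes "f \<in> cube_homs d V R S"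
  shows "A \<subseteq> {..<d} \<Longrightarrow> f A \<in> V"
    and "\<not> A \<subseteq> {..<d} \<Longrightarrow> f A = undefined"
    and "A \<subseteq> {..<d} \<Longrightarrow> B \<subseteq> {..<d} \<Longrightarrow> cube_adj A B \<Longrightarrow> R (f A) (f B)"
    and "A \<in> S \<Longrightarrow> B \<in> S \<Longrightarrow> f A = f B"
  using assms unfolding cube_homs_def PiE_def extensional_def Pi_def by blast+

lemma cube_homsI:
  assumes "\<And>A. A \<subseteq> {..<d} \<Longrightarrow> f A \<in> V" and "\<And>A. \<not> A \<subseteq> {..<d} \<Longrightarrow> f A = undefined"
    and "\<And>A B. A \<subseteq> {..<d} \<Longrightarrow> B \<subseteq> {..<d} \<Longrightarrow> cube_adj A B \<Longrightarrow> R (f A) (f B)"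
    and "\<And>A B. A \<in> S \<Longrightarrow> B \<in> S \<Longrightarrow> f A = f B"
  shows "f \<in> cube_homs d V R S"
  unfolding cube_homs_def PiE_def extensional_def Pi_def using assms by blast

context
  fixes i j :: nat and b :: bool
  assumes ij: "i \<noteq> j"
begin

lemma moved_reflect [simp]: "moved i j b (reflect i j b A) = moved i j b A"
  using ij by (auto simp: moved_def reflect_def)

lemma reflect_reflect [simp]: "reflect i j b (reflect i j b A) = A"
  using ij by (auto simp: reflect_def moved_def split: if_splits)

lemma reflect_fixed: "\<not> moved i j b A \<Longrightarrow> reflect i j b A = A"
  by (simp add: reflect_def)

lemma mem_reflect: "moved i j b A \<Longrightarrow> i \<in> reflect i j b A \<longleftrightarrow> i \<notin> A"
  by (simp add: reflect_def)

lemma reflect_subset: "i < d \<Longrightarrow> j < d \<Longrightarrow> reflect i j b A \<subseteq> {..<d} \<longleftrightarrow> A \<subseteq> {..<d}"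
  by (auto simp: reflect_def)

lemma reflect_side: "A \<notin> side i j b c \<Longrightarrow> reflect i j b A \<in> side i j b c"
  by (auto simp: side_def mem_reflect)

text \<open>The fixed vertices form a vertex cut: among moved vertices, coordinate \<open>i\<close>
  determines coordinate \<open>j\<close>, so changing sides flips both, while an edge flips only
  one.\<close>

lemma cube_adj_sides:
  assumes "cube_adj A B" "A \<notin> side i j b c"
  shows "B \<in> side i j b (\<not> c)"
proof -
  obtain k where "sym_diff A B = {k}" using assms(1) by (auto simp: cube_adj_def)
  then have "\<And>l. (l \<in> A) \<noteq> (l \<in> B) \<longleftrightarrow> l = k" by blast
  then show ?thesis using assms(2) ij unfolding side_def moved_def mem_Collect_eq by metis
qed

lemma cube_adj_reflect:
  assumes "cube_adj A B"
  shows "cube_adj (reflect i j b A) (reflect i j b B)"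
proof -
  obtain k where "sym_diff A B = {k}" using assms by (auto simp: cube_adj_def)
  then have k: "\<And>l. (l \<in> A) \<noteq> (l \<in> B) \<longleftrightarrow> l = k" by blast
  \<comment> \<open>Both reflections are automorphisms that interchange the edge directions
    \<open>i\<close> and \<open>j\<close>.\<close>
  define k' where "k' = (if k = i then j else if k = j then i else k)"
  have "(l \<in> reflect i j b A) \<noteq> (l \<in> reflect i j b B) \<longleftrightarrow> l = k'" for l
    using k[of i] k[of j] k[of l] ij
    unfolding reflect_def moved_def k'_def by (auto split: if_splits)
  then have "sym_diff (reflect i j b A) (reflect i j b B) = {k'}" by blast
  then show ?thesis by (auto simp: cube_adj_def)
qed

text \<open>Two halves from the same side that agree on the fixed vertices are glued after mirroring
  the second one. The key fixes the value at \<open>s\<close> too, so both halves take one common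
  value on the folded coincidence. Nothing is lost: the glued map shows the second half at the
  mirrored vertices, and the key determines it at the fixed ones.\<close>

lemma card_glued_le:
  fixes V :: "'a set" and R :: "'a \<Rightarrow> 'a \<Rightarrow> bool"
  assumes V: "finite V" and d: "i < d" "j < d"
    and s: "s \<in> S" "s \<in> side i j b c" and S: "S \<subseteq> Pow {..<d}"
  defines "A \<equiv> (\<lambda>f. restrict f (Pow {..<d} \<inter> side i j b c)) ` cube_homs d V R S"
    and "key \<equiv> (\<lambda>f. (restrict f (Pow {..<d} \<inter> {A. \<not> moved i j b A}), f s))"
  shows "card {(f, g) \<in> A \<times> A. key f = key g}
    \<le> card (cube_homs d V R (S \<inter> side i j b c \<union> reflect i j b ` (S \<inter> side i j b c)))"
proof -
  let ?r = "reflect i j b" and ?H = "side i j b c"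
  define glue :: "(nat set \<Rightarrow> 'a) \<times> (nat set \<Rightarrow> 'a) \<Rightarrow> nat set \<Rightarrow> 'a" where
    "glue = (\<lambda>(f, g) X. if X \<in> ?H then f X else g (?r X))"
  have fin: "finite (cube_homs d V R (S \<inter> ?H \<union> ?r ` (S \<inter> ?H)))" using V by simp
  have key: "f X = g X" if "key f = key g" "\<not> moved i j b X" "X \<subseteq> {..<d}" for f g X
    using fun_cong[of _ _ X, OF arg_cong[of _ _ fst, OF that(1)]] that(2,3) by (simp add: key_def)
  have out: "f X = undefined" if "f \<in> A" "\<not> (X \<subseteq> {..<d} \<and> X \<in> ?H)" for f X
  proof -
    obtain f0 where "f = restrict f0 (Pow {..<d} \<inter> ?H)" using \<open>f \<in> A\<close> unfolding A_def by blast
    then show ?thesis using that(2) by (metis IntE PowD restrict_apply)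
  qed
  have inj: "inj_on glue {(f, g) \<in> A \<times> A. key f = key g}"
  proof (rule inj_onI)
    fix p q assume p: "p \<in> {(f, g) \<in> A \<times> A. key f = key g}"
      and q: "q \<in> {(f, g) \<in> A \<times> A. key f = key g}" and pq: "glue p = glue q"
    obtain f g f' g' where eqs: "p = (f, g)" "q = (f', g')" by (meson surj_pair)
    have fg: "f \<in> A" "g \<in> A" "key f = key g" "f' \<in> A" "g' \<in> A" "key f' = key g'"
      and eq: "glue (f, g) = glue (f', g')" using p q pq by (simp_all add: eqs)
    have 1: "f X = f' X" for X
    proof (cases "X \<in> ?H")
      case True
      then show ?thesis using fun_cong[OF eq, of X] by (simp add: glue_def)
    next
      case False
      then have "\<not> (X \<subseteq> {..<d} \<and> X \<in> ?H)" by blast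
      then show ?thesis using out[OF fg(1)] out[OF fg(4)] by simp
    qed
    have 2: "g X = g' X" for X
    proof (cases "X \<subseteq> {..<d} \<and> X \<in> ?H")
      case True
      show ?thesis
      proof (cases "moved i j b X")
        case True
        then have "?r X \<notin> ?H" using \<open>X \<subseteq> {..<d} \<and> X \<in> ?H\<close> by (auto simp: side_def mem_reflect)
        then show ?thesis using fun_cong[OF eq, of "?r X"] by (auto simp: glue_def)
      next
        case False
        then show ?thesis using key[OF fg(3) False] key[OF fg(6) False] 1 True by simp
      qed
    next
      case False
      then show ?thesis using out[OF fg(2) False] out[OF fg(5) False] by simp
    qed
    have "f = f'" "g = g'" using 1 2 by (auto intro: ext)
    then show "p = q" by (simp add: eqs)
  qed
  have sub: "glue ` {(f, g) \<in> A \<times> A. key f = key g} \<subseteq> cube_homs d V R (S \<inter> ?H \<union> ?r ` (S \<inter> ?H))"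
  proof (rule image_subsetI)
    fix p assume p: "p \<in> {(f, g) \<in> A \<times> A. key f = key g}"
    obtain f g where eqs: "p = (f, g)" by (meson surj_pair)
    have f: "f \<in> A" and g: "g \<in> A" and k: "key f = key g" using p by (simp_all add: eqs)
    obtain f0 where f0: "f0 \<in> cube_homs d V R S" "f = restrict f0 (Pow {..<d} \<inter> ?H)"
      using f unfolding A_def by blast
    obtain g0 where g0: "g0 \<in> cube_homs d V R S" "g = restrict g0 (Pow {..<d} \<inter> ?H)"
      using g unfolding A_def by blast
    have fix_H: "X \<in> ?H" if "\<not> moved i j b X" for X using that by (simp add: side_def)
    have in_H: "glue (f, g) X = f0 X" if "X \<in> ?H" "X \<subseteq> {..<d}" for X
      using that by (simp add: glue_def f0)
    have in_H': "glue (f, g) X = g0 (?r X)" if "\<not> moved i j b X \<or> X \<notin> ?H" "X \<subseteq> {..<d}" for X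
    proof (cases "moved i j b X")
      case True
      then have "X \<notin> ?H" using that by simp
      then show ?thesis using that(2) reflect_side[of X c] reflect_subset[OF d, of X]
        by (simp add: glue_def g0)
    next
      case False
      then have "glue (f, g) X = f X" using fix_H by (simp add: glue_def)
      also have "\<dots> = g X" using key[OF k False that(2)] .
      also have "\<dots> = g0 X" using that(2) fix_H[OF False] by (simp add: g0)
      finally show ?thesis using False by (simp add: reflect_fixed)
    qed
    have s': "s \<subseteq> {..<d}" using s S by auto
    have fs: "f0 s = g0 s"
      using k s s' by (simp add: key_def f0 g0)
    show "glue p \<in> cube_homs d V R (S \<inter> ?H \<union> ?r ` (S \<inter> ?H))"
      unfolding eqs
    proof (rule cube_homsI)
      fix X assume X: "X \<subseteq> {..<d}"
      show "glue (f, g) X \<in> V"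
        using in_H[OF _ X] in_H'[OF _ X] cube_homsD(1)[OF f0(1), of X]
          cube_homsD(1)[OF g0(1), of "?r X"] X reflect_subset[OF d, of X]
        by (cases "X \<in> ?H") auto
    next
      fix X assume X: "\<not> X \<subseteq> {..<d}"
      then show "glue (f, g) X = undefined"
        using reflect_subset[OF d, of X] by (simp add: glue_def f0 g0)
    next
      fix X Y assume X: "X \<subseteq> {..<d}" and Y: "Y \<subseteq> {..<d}" and adj: "cube_adj X Y"
      show "R (glue (f, g) X) (glue (f, g) Y)"
      proof (cases "X \<in> ?H \<and> Y \<in> ?H")
        case True
        then show ?thesis using in_H X Y cube_homsD(3)[OF f0(1) X Y adj] by simp
      next
        case False
        \<comment> \<open>No edge crosses the cut, so an edge that leaves the side has both ends
          fixed or beyond it, where the glued map is \<open>g0\<close> after reflection.\<close>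
        have adj': "cube_adj Y X" using adj by (auto simp: cube_adj_def Un_commute)
        have "\<not> moved i j b X \<or> X \<notin> ?H" "\<not> moved i j b Y \<or> Y \<notin> ?H"
          using False cube_adj_sides[OF adj, of c] cube_adj_sides[OF adj', of c]
          by (auto simp: side_def)
        then show ?thesis
          using in_H'[OF _ X] in_H'[OF _ Y]
            cube_homsD(3)[OF g0(1) _ _ cube_adj_reflect[OF adj]] X Y reflect_subset[OF d]
          by auto
      qed
    next
      have const: "glue (f, g) X = f0 s" if "X \<in> S \<inter> ?H \<union> ?r ` (S \<inter> ?H)" for X
        using that
      proof
        assume "X \<in> S \<inter> ?H"
        then show ?thesis using in_H[of X] cube_homsD(4)[OF f0(1), of X s] S s by auto
      next
        assume "X \<in> ?r ` (S \<inter> ?H)"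
        then obtain Y where Y: "X = ?r Y" "Y \<in> S" "Y \<in> ?H" by auto
        have "X \<subseteq> {..<d}" using Y S reflect_subset[OF d, of Y] by auto
        moreover have "\<not> moved i j b X \<or> X \<notin> ?H"
          using Y by (auto simp: side_def mem_reflect)
        ultimately have "glue (f, g) X = g0 Y" using in_H' Y by simp
        then show ?thesis using cube_homsD(4)[OF g0(1), of Y s] Y s fs by simp
      qed
      fix X Y assume "X \<in> S \<inter> ?H \<union> ?r ` (S \<inter> ?H)" "Y \<in> S \<inter> ?H \<union> ?r ` (S \<inter> ?H)"
      then show "glue (f, g) X = glue (f, g) Y" using const by metis
    qed
  qed
  from inj sub fin show ?thesis by (rule card_inj_on_le)
qed

text \<open>
  The common value on \<open>S\<close> is part of the key along which the two sides are glued; this is why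
  \<open>S\<close> need not meet the fixed vertices, only both sides.
\<close>

lemma card_cube_homs_reflect:
  assumes V: "finite V" and d: "i < d" "j < d" and S: "S \<subseteq> Pow {..<d}"
    and s: "s \<in> S" "s \<in> side i j b c" and s': "s' \<in> S" "s' \<in> side i j b (\<not> c)"
  shows "(card (cube_homs d V R S))\<^sup>2
    \<le> card (cube_homs d V R (S \<inter> side i j b c \<union> reflect i j b ` (S \<inter> side i j b c)))
      * card (cube_homs d V R (S \<inter> side i j b (\<not> c) \<union> reflect i j b ` (S \<inter> side i j b (\<not> c))))"
proof -
  let ?part = "\<lambda>c. (\<lambda>f. restrict f (Pow {..<d} \<inter> side i j b c)) ` cube_homs d V R S"
  let ?key = "\<lambda>s f. (restrict f (Pow {..<d} \<inter> {A. \<not> moved i j b A}), f s)"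
  let ?P = "\<lambda>c c' s s'. {(f, g) \<in> ?part c \<times> ?part c'. ?key s f = ?key s' g}"
  have fin: "finite (?part c)" for c using V by simp
  \<comment> \<open>A homomorphism is determined by its restrictions to the two sides. Their keys
    agree, since it takes the same value at \<open>s\<close> and at \<open>s'\<close>.\<close>
  have "card (cube_homs d V R S) \<le> card (?P c (\<not> c) s s')"
  proof (rule card_inj_on_le)
    let ?split = "\<lambda>f. (restrict f (Pow {..<d} \<inter> side i j b c), restrict f (Pow {..<d} \<inter> side i j b (\<not> c)))"
    show "finite (?P c (\<not> c) s s')"
      by (rule finite_subset[OF _ finite_cartesian_product[OF fin fin, of c "\<not> c"]]) blast
    show "inj_on ?split (cube_homs d V R S)"
    proof (rule inj_onI, rule ext)
      fix f g X assume f: "f \<in> cube_homs d V R S" and g: "g \<in> cube_homs d V R S" and eq: "?split f = ?split g"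
      have eq': "f X = g X" if "X \<subseteq> {..<d}" "X \<in> side i j b c'" "c' = c \<or> c' = (\<not> c)" for c'
        using fun_cong[OF conjunct1[OF eq[unfolded prod.inject]], of X]
          fun_cong[OF conjunct2[OF eq[unfolded prod.inject]], of X] that by auto
      have "X \<in> side i j b c \<or> X \<in> side i j b (\<not> c)" by (auto simp: side_def)
      then show "f X = g X"
        using eq' cube_homsD(2)[OF f, of X] cube_homsD(2)[OF g, of X] by metis
    qed
    show "?split ` cube_homs d V R S \<subseteq> ?P c (\<not> c) s s'"
    proof (rule image_subsetI)
      fix f assume f: "f \<in> cube_homs d V R S"
      have "f s = f s'" using cube_homsD(4)[OF f] s s' by blast
      moreover have "s \<subseteq> {..<d}" "s' \<subseteq> {..<d}" using S s s' by auto
      moreover have "restrict (restrict f (Pow {..<d} \<inter> side i j b c)) (Pow {..<d} \<inter> {A. \<not> moved i j b A})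
          = restrict (restrict f (Pow {..<d} \<inter> side i j b (\<not> c))) (Pow {..<d} \<inter> {A. \<not> moved i j b A})"
        by (auto simp: side_def restrict_def fun_eq_iff)
      ultimately have "?key s (fst (?split f)) = ?key s' (snd (?split f))"
        using s s' unfolding fst_conv snd_conv prod.inject by simp
      moreover have "fst (?split f) \<in> ?part c" "snd (?split f) \<in> ?part (\<not> c)"
        unfolding fst_conv snd_conv using f by blast+
      ultimately show "?split f \<in> ?P c (\<not> c) s s'"
        unfolding fst_conv snd_conv mem_Collect_eq case_prod_conv by blast
    qed
  qed
  then have "(card (cube_homs d V R S))\<^sup>2 \<le> (card (?P c (\<not> c) s s'))\<^sup>2" by simp
  also have "\<dots> \<le> card (?P c c s s) * card (?P (\<not> c) (\<not> c) s' s')"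
    using card_fibre_product_le[where f = "?key s" and g = "?key s'", OF fin fin, of c "\<not> c"] .
  also have "\<dots> \<le> card (cube_homs d V R (S \<inter> side i j b c \<union> reflect i j b ` (S \<inter> side i j b c)))
      * card (cube_homs d V R (S \<inter> side i j b (\<not> c) \<union> reflect i j b ` (S \<inter> side i j b (\<not> c))))"
    by (rule mult_le_mono[OF card_glued_le[OF V d s S] card_glued_le[OF V d s' S]])
  finally show ?thesis .
qed

end

section \<open>The Sidorenko property\<close>

definition arcs :: "'a set \<Rightarrow> ('a \<Rightarrow> 'a \<Rightarrow> bool) \<Rightarrow> ('a \<times> 'a) set" where
  "arcs V R = {(u, v) \<in> V \<times> V. R u v}"

lemma finite_arcs [simp]: "finite V \<Longrightarrow> finite (arcs V R)"
  by (rule finite_subset[of _ "V \<times> V"]) (auto simp: arcs_def)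

text \<open>Cauchy-Schwarz with \<open>id\<close> on \<open>K\<close> as the second family: the
  mixed fibre product is then the graph of \<open>f\<close>.\<close>

lemma card_power2_le_fibre_product:
  assumes "finite A" "finite K" "f ` A \<subseteq> K"
  shows "(card A)\<^sup>2 \<le> card {(a, a') \<in> A \<times> A. f a = f a'} * card K"
proof -
  have "{(a, k) \<in> A \<times> K. f a = id k} = (\<lambda>a. (a, f a)) ` A" using assms(3) by auto
  then have "card {(a, k) \<in> A \<times> K. f a = id k} = card A" by (simp add: card_image inj_on_def)
  moreover have "{(k, k') \<in> K \<times> K. id k = id k'} = (\<lambda>k. (k, k)) ` K" by auto
  then have "card {(k, k') \<in> K \<times> K. id k = id k'} = card K" by (simp add: card_image inj_on_def)
  ultimately show ?thesis using card_fibre_product_le[OF assms(1,2), of f id] by simp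
qed

text \<open>The Sidorenko bound for the 4-cycle: pairs of arcs with a common start form paths of
  length two, and pairs of such paths with the same ends form closed walks of length four.\<close>

lemma card_arcs_power4_le:
  assumes V: "finite V" and sym: "\<And>u v. R u v \<Longrightarrow> R v u"
  shows "card (arcs V R) ^ 4
    \<le> card V ^ 4 * card (arcs (arcs V R) (\<lambda>p q. R (fst p) (fst q) \<and> R (snd p) (snd q)))"
proof -
  let ?E = "arcs V R"
  let ?C = "arcs (arcs V R) (\<lambda>p q. R (fst p) (fst q) \<and> R (snd p) (snd q))"
  define P where "P = {(a, b) \<in> ?E \<times> ?E. fst a = fst b}"
  define Q where "Q = {(p, q) \<in> P \<times> P. map_prod snd snd p = map_prod snd snd q}"
  have finP: "finite P" by (rule finite_subset[of _ "?E \<times> ?E"]) (use V in \<open>auto simp: P_def\<close>)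
  have 1: "(card ?E)\<^sup>2 \<le> card P * card V"
    unfolding P_def by (rule card_power2_le_fibre_product[OF finite_arcs[OF V] V]) (auto simp: arcs_def)
  have "(card P)\<^sup>2 \<le> card Q * card (V \<times> V)"
    unfolding Q_def using V
    by (intro card_power2_le_fibre_product[OF finP]) (auto simp: P_def arcs_def)
  then have 2: "(card P)\<^sup>2 \<le> card Q * (card V)\<^sup>2" by (simp add: card_cartesian_product power2_eq_square)
  have 3: "card Q \<le> card ?C"
  proof (rule card_inj_on_le)
    \<comment> \<open>The paths v, u, w and v, u', w are read as the opposite sides (u, v) and (w,
      u') of the 4-cycle.\<close>
    show "inj_on (\<lambda>((a, b), (a', b')). (a, (snd b, fst a'))) Q"
      by (auto simp: inj_on_def Q_def P_def)
    show "(\<lambda>((a, b), (a', b')). (a, (snd b, fst a'))) ` Q \<subseteq> ?C"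
      using sym by (auto simp: Q_def P_def arcs_def)
  qed (use V in simp)
  have "card ?E ^ 4 = ((card ?E)\<^sup>2)\<^sup>2" by (simp flip: power_mult)
  also have "\<dots> \<le> (card P * card V)\<^sup>2" using 1 by (rule power_mono) simp
  also have "\<dots> = (card P)\<^sup>2 * (card V)\<^sup>2" by (rule power_mult_distrib)
  also have "\<dots> \<le> card ?C * (card V)\<^sup>2 * (card V)\<^sup>2"
    using 2 3 by (meson le_trans mult_le_mono1)
  finally show ?thesis by (simp add: mult.commute mult.assoc flip: power_add)
qed

text \<open>Coordinate \<open>m\<close> selects an end of the arc. Edges in that direction run along
  an arc, and all others stay within one of the two components.\<close>

lemma card_cube_homs_prod_le:
  assumes V: "finite V" and sym: "\<And>u v. R u v \<Longrightarrow> R v u"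
  shows "card (cube_homs m (arcs V R) (\<lambda>p q. R (fst p) (fst q) \<and> R (snd p) (snd q)) {})
    \<le> card (cube_homs (Suc m) V R {})"
proof (rule card_inj_on_le)
  let ?R = "\<lambda>p q. R (fst p) (fst q) \<and> R (snd p) (snd q)"
  define lift :: "(nat set \<Rightarrow> 'a \<times> 'a) \<Rightarrow> nat set \<Rightarrow> 'a" where
    "lift f A = (if A \<subseteq> {..<Suc m} then (if m \<in> A then snd else fst) (f (A - {m})) else undefined)" for f A
  have low: "A - {m} \<subseteq> {..<m}" if "A \<subseteq> {..<Suc m}" for A
    using that by (auto simp: less_Suc_eq)
  show "inj_on lift (cube_homs m (arcs V R) ?R {})"
  proof (intro inj_onI ext)
    fix f g A assume f: "f \<in> cube_homs m (arcs V R) ?R {}" and g: "g \<in> cube_homs m (arcs V R) ?R {}"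
      and eq: "lift f = lift g"
    show "f A = g A"
    proof (cases "A \<subseteq> {..<m}")
      case True
      have rec: "h A = (lift h A, lift h (insert m A))" for h
        using True by (auto simp: lift_def insert_absorb)
      show ?thesis unfolding rec eq ..
    next
      case False
      then show ?thesis using cube_homsD(2)[OF f] cube_homsD(2)[OF g] by metis
    qed
  qed
  show "lift ` cube_homs m (arcs V R) ?R {} \<subseteq> cube_homs (Suc m) V R {}"
  proof (rule image_subsetI)
    fix f assume f: "f \<in> cube_homs m (arcs V R) ?R {}"
    have arc: "fst (f (A - {m})) \<in> V" "snd (f (A - {m})) \<in> V" "R (fst (f (A - {m}))) (snd (f (A - {m})))"
      if "A \<subseteq> {..<Suc m}" for A
      using cube_homsD(1)[OF f low[OF that]] by (auto simp: arcs_def)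
    show "lift f \<in> cube_homs (Suc m) V R {}"
    proof (rule cube_homsI)
      fix A assume "A \<subseteq> {..<Suc m}" then show "lift f A \<in> V" using arc[of A] by (cases "m \<in> A") (simp_all add: lift_def)
    next
      fix A assume "\<not> A \<subseteq> {..<Suc m}" then show "lift f A = undefined" by (simp add: lift_def)
    next
      fix A B assume AB: "A \<subseteq> {..<Suc m}" "B \<subseteq> {..<Suc m}" and "cube_adj A B"
      then obtain k where k: "sym_diff A B = {k}" by (auto simp: cube_adj_def)
      show "R (lift f A) (lift f B)"
      proof (cases "k = m")
        case True
        then have "A - {m} = B - {m}" "m \<in> A \<longleftrightarrow> m \<notin> B" using k by blast+
        then show ?thesis using arc[OF AB(1)] AB sym by (auto simp: lift_def)
      next
        case False
        then have "m \<notin> sym_diff A B" using k by simp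
        then have mem: "m \<in> A \<longleftrightarrow> m \<in> B" by blast
        have "sym_diff (A - {m}) (B - {m}) = sym_diff A B - {m}" by blast
        also have "\<dots> = {k}" unfolding k using False by simp
        finally have "sym_diff (A - {m}) (B - {m}) = {k}" .
        then have "cube_adj (A - {m}) (B - {m})" by (simp add: cube_adj_def)
        then have "?R (f (A - {m})) (f (B - {m}))"
          by (rule cube_homsD(3)[OF f low[OF AB(1)] low[OF AB(2)]])
        then show ?thesis using AB mem by (cases "m \<in> B") (simp_all add: lift_def)
      qed
    qed simp
  qed
qed (use V in simp)

text \<open>Serves to carry the graph of arcs back to natural numbers by
  \<open>prod_encode\<close>.\<close>

lemma card_cube_homs_inj_image:
  assumes V: "finite V" and inj: "inj_on g V"
    and R: "\<And>u v. u \<in> V \<Longrightarrow> v \<in> V \<Longrightarrow> R' (g u) (g v) = R u v"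
  shows "card (cube_homs d (g ` V) R' {}) \<le> card (cube_homs d V R {})"
proof (rule card_inj_on_le)
  let ?pull = "\<lambda>f. \<lambda>A\<in>Pow {..<d}. inv_into V g (f A)"
  show "inj_on ?pull (cube_homs d (g ` V) R' {})"
  proof (intro inj_onI ext)
    fix f h A assume f: "f \<in> cube_homs d (g ` V) R' {}" and h: "h \<in> cube_homs d (g ` V) R' {}"
      and eq: "?pull f = ?pull h"
    show "f A = h A"
    proof (cases "A \<subseteq> {..<d}")
      case True
      then have "inv_into V g (f A) = inv_into V g (h A)" using fun_cong[OF eq, of A] by simp
      then show ?thesis using cube_homsD(1)[OF f True] cube_homsD(1)[OF h True] by (metis f_inv_into_f)
    next
      case False
      then show ?thesis using cube_homsD(2)[OF f] cube_homsD(2)[OF h] by metis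
    qed
  qed
  show "?pull ` cube_homs d (g ` V) R' {} \<subseteq> cube_homs d V R {}"
  proof (rule image_subsetI)
    fix f assume f: "f \<in> cube_homs d (g ` V) R' {}"
    have inv: "inv_into V g (f A) \<in> V" "g (inv_into V g (f A)) = f A" if "A \<subseteq> {..<d}" for A
      using cube_homsD(1)[OF f that] by (simp_all add: inv_into_into f_inv_into_f)
    show "?pull f \<in> cube_homs d V R {}"
    proof (rule cube_homsI)
      fix A B assume AB: "A \<subseteq> {..<d}" "B \<subseteq> {..<d}" "cube_adj A B"
      have "R (inv_into V g (f A)) (inv_into V g (f B))"
        unfolding R[OF inv(1)[OF AB(1)] inv(1)[OF AB(2)], symmetric] inv(2)[OF AB(1)] inv(2)[OF AB(2)]
        by (rule cube_homsD(3)[OF f AB])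
      then show "R (?pull f A) (?pull f B)" using AB by simp
    qed (simp_all add: inv(1))
  qed
qed (use V in simp)

text \<open>
  The vertex type is \<open>nat\<close> because the induction passes to a graph on pairs of vertices.
\<close>

lemma cube_homs_sidorenko:
  fixes V :: "nat set"
  assumes "finite V" and "\<And>u v. R u v \<Longrightarrow> R v u"
  shows "card (arcs V R) ^ (Suc d * 2 ^ d) \<le> card (cube_homs (Suc d) V R {}) * card V ^ (d * 2 ^ Suc d)"
  using assms
proof (induction d arbitrary: V R)
  case 0
  have "card (arcs V R) \<le> card (cube_homs (Suc 0) V R {})"
  proof (rule card_inj_on_le)
    let ?f = "\<lambda>(u, v). \<lambda>A\<in>Pow {..<Suc 0}. if 0 \<in> A then v else u"
    show "inj_on ?f (arcs V R)"
    proof (rule inj_onI)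
      fix p q :: "nat \<times> nat" assume "?f p = ?f q"
      then have "?f p {} = ?f q {}" "?f p {0} = ?f q {0}" by simp_all
      then show "p = q" by (cases p; cases q) simp
    qed
    show "?f ` arcs V R \<subseteq> cube_homs (Suc 0) V R {}"
    proof (rule image_subsetI)
      fix p assume p: "p \<in> arcs V R"
      obtain u v where uv: "p = (u, v)" by (meson surj_pair)
      have R: "u \<in> V" "v \<in> V" "R u v" "R v u" using p 0(2) by (auto simp: uv arcs_def)
      show "?f p \<in> cube_homs (Suc 0) V R {}"
      proof (rule cube_homsI)
        fix A B assume AB: "A \<subseteq> {..<Suc 0}" "B \<subseteq> {..<Suc 0}" "cube_adj A B"
        then obtain k where k: "sym_diff A B = {k}" by (auto simp: cube_adj_def)
        then have "k \<in> A \<union> B" by blast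
        then have "k = 0" using AB by auto
        then have "0 \<in> A \<longleftrightarrow> 0 \<notin> B" using k by blast
        then show "R (?f p A) (?f p B)" using AB R by (simp add: uv)
      qed (use R in \<open>auto simp: uv\<close>)
    qed
  qed (use 0 in simp)
  then show ?case by simp
next
  case (Suc d)
  let ?R = "\<lambda>p q. R (fst p) (fst q) \<and> R (snd p) (snd q)"
  let ?E = "arcs V R"
  let ?e = "card ?E" and ?n = "card V"
  define V' where "V' = prod_encode ` ?E"
  define R' where "R' p q = ?R (prod_decode p) (prod_decode q)" for p q
  have finE: "finite ?E" using Suc by simp
  have cV': "card V' = ?e" unfolding V'_def by (intro card_image inj_onI) simp
  have "arcs V' R' = map_prod prod_encode prod_encode ` arcs ?E ?R"
    by (force simp: arcs_def V'_def R'_def image_iff)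
  then have cE': "card (arcs V' R') = card (arcs ?E ?R)"
    by (simp add: card_image inj_on_def map_prod_def case_prod_unfold prod_eq_iff)
  have "card (cube_homs (Suc d) V' R' {}) \<le> card (cube_homs (Suc d) ?E ?R {})"
    unfolding V'_def using finE by (intro card_cube_homs_inj_image) (auto simp: inj_on_def R'_def)
  also have "\<dots> \<le> card (cube_homs (Suc (Suc d)) V R {})"
    using Suc by (intro card_cube_homs_prod_le)
  finally have h: "card (cube_homs (Suc d) V' R' {}) \<le> card (cube_homs (Suc (Suc d)) V R {})" .
  let ?h = "card (cube_homs (Suc (Suc d)) V R {})"
  \<comment> \<open>\<open>k\<close> is the number of edges of the (d+1)-cube. The claim says that
    the homomorphism density is at least the edge density raised to the number of edges; all powers
    of \<open>?n\<close> are collected on the right.\<close>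
  define k where "k = Suc d * 2 ^ d"
  have IH: "card (arcs V' R') ^ k \<le> card (cube_homs (Suc d) V' R' {}) * card V' ^ (d * 2 ^ Suc d)"
    unfolding k_def using finE Suc(3) by (intro Suc.IH) (auto simp: V'_def R'_def)
  have "?e ^ (4 * k) = (?e ^ 4) ^ k" by (rule power_mult)
  also have "\<dots> \<le> (?n ^ 4 * card (arcs ?E ?R)) ^ k"
    using Suc by (intro power_mono card_arcs_power4_le) auto
  also have "\<dots> = ?n ^ (4 * k) * card (arcs V' R') ^ k"
    by (simp add: power_mult_distrib cE' flip: power_mult)
  also have "\<dots> \<le> ?n ^ (4 * k) * (?h * ?e ^ (d * 2 ^ Suc d))"
    using IH h unfolding cV' by (meson le_trans mult_le_mono1 mult_le_mono2)
  finally have main: "?e ^ (4 * k) \<le> ?n ^ (4 * k) * (?h * ?e ^ (d * 2 ^ Suc d))" .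
  \<comment> \<open>The first splitting exposes the power of \<open>?e\<close> that the induction
    hypothesis puts on the right, so that it cancels.\<close>
  have k1: "4 * k = Suc (Suc d) * 2 ^ Suc d + d * 2 ^ Suc d" and k2: "4 * k = Suc d * 2 ^ Suc (Suc d)"
    by (simp_all add: k_def algebra_simps)
  show ?case
  proof (cases "?e = 0")
    case True
    then show ?thesis by (simp add: zero_power)
  next
    case False
    have "?e ^ (Suc (Suc d) * 2 ^ Suc d) * ?e ^ (d * 2 ^ Suc d)
        \<le> (?h * ?n ^ (Suc d * 2 ^ Suc (Suc d))) * ?e ^ (d * 2 ^ Suc d)"
      using main unfolding k2[symmetric] power_add [symmetric] k1[symmetric]
      by (simp only: mult.assoc mult.commute mult.left_commute)
    then show ?thesis using False by simp
  qed
qed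

section \<open>Spreading a coincidence\<close>

text \<open>A fixed vertex of \<open>S\<close> lies on both sides and serves as representative for
  each. On the far side the coincidence is forgotten altogether, at the price of the factor for
  \<open>{}\<close>.\<close>

lemma card_cube_homs_reflect_one_side:
  assumes V: "finite V" and d: "i \<noteq> j" "i < d" "j < d" and S: "S \<subseteq> Pow {..<d}" "S \<subseteq> side i j b c"
    and s: "s \<in> S" "\<not> moved i j b s"
  shows "(card (cube_homs d V R S))\<^sup>2
    \<le> card (cube_homs d V R (S \<union> reflect i j b ` S)) * card (cube_homs d V R {})"
proof -
  have *: "s \<in> side i j b c'" for c' using s by (simp add: side_def)
  have "S \<inter> side i j b c = S" using S(2) by blast
  then have "(card (cube_homs d V R S))\<^sup>2 \<le> card (cube_homs d V R (S \<union> reflect i j b ` S))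
      * card (cube_homs d V R (S \<inter> side i j b (\<not> c) \<union> reflect i j b ` (S \<inter> side i j b (\<not> c))))"
    using card_cube_homs_reflect[OF d(1) V d(2,3) S(1) s(1) * s(1) *, where c = c and R = R] by simp
  also have "\<dots> \<le> card (cube_homs d V R (S \<union> reflect i j b ` S)) * card (cube_homs d V R {})"
    by (intro mult_le_mono2 card_mono finite_cube_homs V cube_homs_antimono) simp
  finally show ?thesis .
qed

definition even_subsets :: "'a set \<Rightarrow> 'a set set" where
  "even_subsets I = {A. A \<subseteq> I \<and> even (card A)}"

lemma even_card_sym_diff_pair:
  assumes "finite A" "i \<noteq> j"
  shows "even (card (sym_diff A {i, j})) = even (card A)"
proof -
  have "sym_diff A {i, j} \<union> (A \<inter> {i, j}) = A \<union> {i, j}" "sym_diff A {i, j} \<inter> (A \<inter> {i, j}) = {}" by blast+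
  then have "card (sym_diff A {i, j}) + card (A \<inter> {i, j}) = card (A \<union> {i, j})"
    using assms card_Un_disjoint[of "sym_diff A {i, j}" "A \<inter> {i, j}"] by simp
  moreover have "card (A \<union> {i, j}) + card (A \<inter> {i, j}) = card A + 2"
    using assms card_Un_Int[of A "{i, j}"] by simp
  ultimately show ?thesis by presburger
qed

text \<open>
  Folding along \<open>x\<^sub>i = x\<^sub>j\<close> adds the sets containing \<open>j\<close> but not \<open>i\<close>; folding the result along
  \<open>x\<^sub>i = 1 - x\<^sub>j\<close> adds those containing both.
\<close>

lemma card_cube_homs_even_subsets_insert:
  assumes V: "finite V" and I: "I \<subseteq> {..<d}" "i \<in> I" "i' \<in> I" "i \<noteq> i'" and j: "j < d" "j \<notin> I"
  shows "card (cube_homs d V R (even_subsets I)) ^ 4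
    \<le> card (cube_homs d V R (even_subsets (insert j I))) * card (cube_homs d V R {}) ^ 3"
proof -
  let ?h = "\<lambda>S. card (cube_homs d V R S)"
  have ij: "i \<noteq> j" and id: "i < d" using I j by auto
  have fin: "finite A" if "A \<subseteq> insert j I" for A
    using that I(1) finite_subset[of A "{..<Suc (d + j)}"] by fastforce
  define S where "S = even_subsets I"
  define S' where "S' = S \<union> reflect i j True ` S"
  define S'' where "S'' = S' \<union> reflect i j False ` S'"
  have SI: "A \<subseteq> I" "even (card A)" if "A \<in> S" for A using that by (auto simp: S_def even_subsets_def)
  have S1: "S \<subseteq> Pow {..<d}" using SI I(1) by blast
  have S2: "S \<subseteq> side i j True True" using SI j(2) by (auto simp: side_def moved_def)
  have S3: "{} \<in> S" "\<not> moved i j True {}" by (auto simp: S_def even_subsets_def moved_def)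
  have 1: "(?h S)\<^sup>2 \<le> ?h S' * ?h {}"
    unfolding S'_def by (rule card_cube_homs_reflect_one_side[OF V ij id j(1) S1 S2 S3])
  have S'1: "S' \<subseteq> Pow {..<d}"
    using S1 reflect_subset[OF ij id j(1), of True] unfolding S'_def by blast
  have "\<not> (i \<in> A \<and> j \<in> A)" if A: "A \<in> S'" for A
  proof -
    obtain B where "B \<in> S" "A = B \<or> A = reflect i j True B" using A by (auto simp: S'_def)
    then show ?thesis using SI(1)[of B] j(2) ij by (auto simp: reflect_def moved_def split: if_splits)
  qed
  then have S'2: "S' \<subseteq> side i j False False" by (auto simp: side_def moved_def)
  \<comment> \<open>The second mirror fixes the sets that contain exactly one of \<open>i\<close>
    and \<open>j\<close>. This is why \<open>I\<close> must have a second element: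
    \<open>{i, i'}\<close> is an even set of this kind.\<close>
  have S'3: "{i, i'} \<in> S'" "\<not> moved i j False {i, i'}"
    using I j ij by (auto simp: S'_def S_def even_subsets_def moved_def)
  have 2: "(?h S')\<^sup>2 \<le> ?h S'' * ?h {}"
    unfolding S''_def by (rule card_cube_homs_reflect_one_side[OF V ij id j(1) S'1 S'2 S'3])
  have "even_subsets (insert j I) \<subseteq> S''"
  proof
    fix A assume "A \<in> even_subsets (insert j I)"
    then have A: "A \<subseteq> insert j I" "even (card A)" by (auto simp: even_subsets_def)
    show "A \<in> S''"
    proof (cases "j \<in> A")
      case False
      then show ?thesis using A by (auto simp: S''_def S'_def S_def even_subsets_def)
    next
      case jA: True
      have "reflect i j b A \<in> S" if "b = (i \<notin> A)" for b
      proof -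
        have "reflect i j b A = sym_diff A {i, j}" using jA that by (auto simp: reflect_def moved_def)
        then show ?thesis
          using A jA I(2) even_card_sym_diff_pair[OF fin[OF A(1)] ij]
          by (auto simp: S_def even_subsets_def)
      qed
      then have "\<exists>b. reflect i j b A \<in> S" by blast
      then obtain b where "reflect i j b A \<in> S" by blast
      moreover have "A = reflect i j b (reflect i j b A)" using ij by simp
      ultimately have "A \<in> reflect i j b ` S" by blast
      then show ?thesis by (cases b) (auto simp: S''_def S'_def)
    qed
  qed
  then have 3: "?h S'' \<le> ?h (even_subsets (insert j I))"
    by (intro card_mono finite_cube_homs V cube_homs_antimono)
  have "?h S ^ 4 = ((?h S)\<^sup>2)\<^sup>2" by (simp flip: power_mult)
  also have "\<dots> \<le> (?h S' * ?h {})\<^sup>2" using 1 by (rule power_mono) simp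
  also have "\<dots> = (?h S')\<^sup>2 * (?h {})\<^sup>2" by (rule power_mult_distrib)
  also have "\<dots> \<le> ?h (even_subsets (insert j I)) * ?h {} * (?h {})\<^sup>2"
    using 2 3 by (meson le_trans mult_le_mono1)
  finally show ?thesis by (simp add: S_def power2_eq_square power3_eq_cube mult.assoc)
qed

text \<open>Each new coordinate takes two foldings, hence a fourth power. The counts for
  \<open>{}\<close> keep both sides of the same degree.\<close>

lemma card_cube_homs_even_subsets_Un:
  assumes V: "finite V" and I: "I \<subseteq> {..<d}" "i \<in> I" "i' \<in> I" "i \<noteq> i'"
    and K: "K \<subseteq> {..<d} - I"
  shows "card (cube_homs d V R (even_subsets I)) ^ (4 ^ card K)
    \<le> card (cube_homs d V R (even_subsets (I \<union> K))) * card (cube_homs d V R {}) ^ (4 ^ card K - 1)"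
proof -
  let ?h = "\<lambda>S. card (cube_homs d V R S)"
  have "finite K" using K finite_subset by blast
  then show ?thesis using K
  proof (induction K)
    case empty
    then show ?case by simp
  next
    case (insert j K)
    define q :: nat where "q = 4 ^ card K"
    have q: "q \<ge> 1" by (simp add: q_def)
    have "?h (even_subsets I) ^ (4 * q) = (?h (even_subsets I) ^ q) ^ 4"
      by (simp flip: power_mult add: mult.commute)
    also have "\<dots> \<le> (?h (even_subsets (I \<union> K)) * ?h {} ^ (q - 1)) ^ 4"
      using insert by (intro power_mono) (auto simp: q_def)
    also have "\<dots> = ?h (even_subsets (I \<union> K)) ^ 4 * ?h {} ^ (4 * (q - 1))"
      by (simp add: power_mult_distrib mult.commute flip: power_mult)
    also have "\<dots> \<le> ?h (even_subsets (insert j (I \<union> K))) * ?h {} ^ 3 * ?h {} ^ (4 * (q - 1))"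
      using insert I
      by (intro mult_le_mono1 card_cube_homs_even_subsets_insert[OF V, of _ _ i i']) auto
    also have "\<dots> = ?h (even_subsets (I \<union> insert j K)) * ?h {} ^ (4 * q - 1)"
      using q by (simp add: mult.assoc flip: power_add) (simp add: diff_mult_distrib2)
    finally show ?case using insert by (simp add: q_def)
  qed
qed

lemma cube_adj_sym_diff: "cube_adj (sym_diff A x) (sym_diff B x) = cube_adj A B"
proof -
  have "sym_diff (sym_diff A x) (sym_diff B x) = sym_diff A B" by blast
  then show ?thesis unfolding cube_adj_def by simp
qed

text \<open>Translations are automorphisms of the cube. They move a coincidence to one that contains
  the empty set.\<close>

lemma card_cube_homs_translate:
  assumes V: "finite V" and x: "x \<subseteq> {..<d}"
  shows "card (cube_homs d V R S) \<le> card (cube_homs d V R ((\<lambda>A. sym_diff A x) ` S))"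
proof (rule card_inj_on_le)
  let ?t = "\<lambda>A. sym_diff A x"
  have tt: "?t (?t A) = A" for A by blast
  have sub: "?t A \<subseteq> {..<d} \<longleftrightarrow> A \<subseteq> {..<d}" for A using x by blast
  show "inj_on (\<lambda>f A. f (?t A)) (cube_homs d V R S)"
  proof (intro inj_onI ext)
    fix f g :: "nat set \<Rightarrow> 'a" and A assume "(\<lambda>A. f (?t A)) = (\<lambda>A. g (?t A))"
    from fun_cong[OF this, of "?t A"] show "f A = g A" unfolding tt .
  qed
  show "(\<lambda>f A. f (?t A)) ` cube_homs d V R S \<subseteq> cube_homs d V R (?t ` S)"
  proof (rule image_subsetI)
    fix f assume f: "f \<in> cube_homs d V R S"
    show "(\<lambda>A. f (?t A)) \<in> cube_homs d V R (?t ` S)"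
    proof (rule cube_homsI)
      fix A B assume "A \<in> ?t ` S" "B \<in> ?t ` S"
      then obtain A' B' where "A = ?t A'" "B = ?t B'" "A' \<in> S" "B' \<in> S" by blast
      then have "?t A \<in> S" "?t B \<in> S" using tt[of A'] tt[of B'] by metis+
      then show "f (?t A) = f (?t B)" by (rule cube_homsD(4)[OF f])
    next
      fix A assume "A \<subseteq> {..<d}" then show "f (?t A) \<in> V" by (intro cube_homsD(1)[OF f] sub[THEN iffD2])
    next
      fix A assume "\<not> A \<subseteq> {..<d}" then show "f (?t A) = undefined" unfolding sub[of A, symmetric] by (rule cube_homsD(2)[OF f])
    next
      fix A B assume "A \<subseteq> {..<d}" "B \<subseteq> {..<d}" "cube_adj A B"
      then show "R (f (?t A)) (f (?t B))"
        using cube_homsD(3)[OF f, of "?t A" "?t B"] unfolding cube_adj_sym_diff sub by blast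
    qed
  qed
qed (use V in simp)

lemma card_cube_homs_pair_le:
  assumes V: "finite V" and xy: "x \<subseteq> {..<d}" "y \<subseteq> {..<d}" "i \<in> sym_diff x y" "j \<in> sym_diff x y" "i \<noteq> j"
  shows "card (cube_homs d V R {x, y}) \<le> card (cube_homs d V R (even_subsets {i, j}))"
proof -
  let ?h = "\<lambda>S. card (cube_homs d V R S)"
  have d: "i < d" "j < d" using xy by auto
  define b where "b = ((i \<in> x) \<noteq> (j \<in> x))"
  define c where "c = (i \<in> x)"
  have m: "moved i j b x" "moved i j b y" using xy by (auto simp: moved_def b_def)
  have sides: "x \<in> side i j b c" "x \<notin> side i j b (\<not> c)" "y \<in> side i j b (\<not> c)" "y \<notin> side i j b c"
    using m xy by (auto simp: side_def c_def)
  have le: "?h {z, reflect i j b z} \<le> ?h (even_subsets {i, j})" if z: "z \<subseteq> {..<d}" "moved i j b z" for z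
  proof -
    have e: "even_subsets {i, j} \<subseteq> {{}, {i, j}}"
    proof
      fix A assume "A \<in> even_subsets {i, j}"
      then have "A \<in> Pow {i, j}" "even (card A)" by (simp_all add: even_subsets_def)
      then show "A \<in> {{}, {i, j}}" unfolding Pow_insert Pow_empty by auto
    qed
    have "(\<lambda>A. sym_diff A z) ` {z, reflect i j b z} = {{}, {i, j}}"
    proof -
      have "sym_diff (sym_diff z {i, j}) z = {i, j}" by blast
      then show ?thesis using z(2) by (simp add: reflect_def)
    qed
    then have "?h {z, reflect i j b z} \<le> ?h {{}, {i, j}}"
      using card_cube_homs_translate[OF V z(1), of R "{z, reflect i j b z}"] by simp
    also have "\<dots> \<le> ?h (even_subsets {i, j})"
      by (intro card_mono finite_cube_homs V cube_homs_antimono e)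
    finally show ?thesis .
  qed
  have "{x, y} \<inter> side i j b c \<union> reflect i j b ` ({x, y} \<inter> side i j b c) = {x, reflect i j b x}"
    "{x, y} \<inter> side i j b (\<not> c) \<union> reflect i j b ` ({x, y} \<inter> side i j b (\<not> c)) = {y, reflect i j b y}"
    using sides by auto
  then have "(?h {x, y})\<^sup>2 \<le> ?h {x, reflect i j b x} * ?h {y, reflect i j b y}"
    using card_cube_homs_reflect[OF xy(5) V d, where S = "{x, y}" and s = x and s' = y and b = b and c = c and R = R] sides xy(1,2) by auto
  also have "\<dots> \<le> (?h (even_subsets {i, j}))\<^sup>2"
    unfolding power2_eq_square by (intro mult_le_mono le xy m)
  finally show ?thesis by (rule power2_le_imp_le) simp
qed

text \<open>Adjacent vertices cannot be identified in a loopless graph. Otherwise two differing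
  coordinates are available, and the remaining \<open>d - 2\<close> are added to them.\<close>

lemma card_cube_homs_pair_power_le:
  assumes V: "finite V" and irr: "\<And>v. v \<in> V \<Longrightarrow> \<not> R v v"
    and xy: "x \<subseteq> {..<d}" "y \<subseteq> {..<d}" "x \<noteq> y"
  shows "card (cube_homs d V R {x, y}) ^ (4 ^ (d - 2))
    \<le> card (cube_homs d V R (even_subsets {..<d})) * card (cube_homs d V R {}) ^ (4 ^ (d - 2) - 1)"
proof (cases "\<exists>i j. i \<in> sym_diff x y \<and> j \<in> sym_diff x y \<and> i \<noteq> j")
  case True
  then obtain i j where ij: "i \<in> sym_diff x y" "j \<in> sym_diff x y" "i \<noteq> j" by blast
  have sub: "{i, j} \<subseteq> {..<d}" using ij xy by auto
  have "card ({..<d} - {i, j}) = d - 2" "{i, j} \<union> ({..<d} - {i, j}) = {..<d}"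
    using sub ij(3) by (auto simp: card_Diff_subset)
  moreover have "card (cube_homs d V R {x, y}) ^ (4 ^ (d - 2)) \<le> card (cube_homs d V R (even_subsets {i, j})) ^ (4 ^ (d - 2))"
    using card_cube_homs_pair_le[OF V xy(1,2) ij] by (rule power_mono) simp
  moreover have "card (cube_homs d V R (even_subsets {i, j})) ^ (4 ^ card ({..<d} - {i, j}))
    \<le> card (cube_homs d V R (even_subsets ({i, j} \<union> ({..<d} - {i, j}))))
      * card (cube_homs d V R {}) ^ (4 ^ card ({..<d} - {i, j}) - 1)"
    by (rule card_cube_homs_even_subsets_Un[OF V sub _ _ ij(3)]) auto
  ultimately show ?thesis by (simp only: le_trans)
next
  case False
  then have "\<exists>k. sym_diff x y = {k}" using xy(3) by blast
  then have adj: "cube_adj x y" by (simp add: cube_adj_def)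
  have "cube_homs d V R {x, y} = {}"
  proof (rule equals0I)
    fix f assume f: "f \<in> cube_homs d V R {x, y}"
    have "f x = f y" using cube_homsD(4)[OF f] by blast
    then show False using cube_homsD(3)[OF f xy(1,2) adj] irr cube_homsD(1)[OF f xy(1)] by simp
  qed
  then show ?thesis by (simp add: zero_power)
qed

lemma card_odd_subsets:
  assumes "d \<ge> 1"
  shows "card {A. A \<subseteq> {..<d} \<and> odd (card A)} = 2 ^ (d - 1)"
proof -
  let ?t = "\<lambda>A. sym_diff A {0 :: nat}"
  let ?E = "{A. A \<subseteq> {..<d} \<and> even (card A)}" and ?O = "{A. A \<subseteq> {..<d} \<and> odd (card A)}"
  have tt: "?t (?t A) = A" for A by blast
  have par: "even (card (?t A)) = odd (card A)" if "A \<subseteq> {..<d}" for A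
  proof -
    have "finite A" using that finite_subset by blast
    moreover from this have "0 \<in> A \<Longrightarrow> card A > 0" by (auto simp: card_gt_0_iff)
    ultimately show ?thesis
      by (cases "0 \<in> A") (auto simp: card_insert_if insert_absorb)
  qed
  have sub: "?t A \<subseteq> {..<d} \<longleftrightarrow> A \<subseteq> {..<d}" for A using assms by auto
  have "bij_betw ?t ?E ?O"
  proof (rule bij_betw_byWitness[where f' = ?t])
    show "\<forall>A\<in>?E. ?t (?t A) = A" "\<forall>A\<in>?O. ?t (?t A) = A" by (intro ballI tt)+
    show "?t ` ?E \<subseteq> ?O"
    proof (rule image_subsetI)
      fix A assume "A \<in> ?E" then show "?t A \<in> ?O" using sub[of A] par[of A] by simp
    qed
    show "?t ` ?O \<subseteq> ?E"
    proof (rule image_subsetI)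
      fix A assume "A \<in> ?O" then show "?t A \<in> ?E" using sub[of A] par[of A] by simp
    qed
  qed
  then have "card ?E = card ?O" by (rule bij_betw_same_card)
  moreover have "card (?E \<union> ?O) = card ?E + card ?O"
    by (rule card_Un_disjoint) auto
  moreover have "?E \<union> ?O = Pow {..<d}" by auto
  ultimately have "2 * card ?O = 2 ^ d" by (simp add: card_Pow)
  then show ?thesis using assms by (cases d) auto
qed

lemma card_cube_homs_even_subsets_le:
  assumes V: "finite V" and d: "d \<ge> 1" and D: "\<And>v. v \<in> V \<Longrightarrow> card {u \<in> V. R v u} \<le> D"
  shows "card (cube_homs d V R (even_subsets {..<d})) \<le> card V * D ^ (2 ^ (d - 1))"
proof -
  let ?O = "{A. A \<subseteq> {..<d} \<and> odd (card A)}"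
  let ?T = "SIGMA v : V. PiE ?O (\<lambda>_. {u \<in> V. R v u})"
  let ?key = "\<lambda>f. (f {}, restrict f ?O)"
  have fin: "finite ?O" by (rule finite_subset[of _ "Pow {..<d}"]) auto
  have finT: "finite ?T" using V fin by (intro finite_SigmaI finite_PiE) auto
  have "card (cube_homs d V R (even_subsets {..<d})) \<le> card ?T"
  proof (rule card_inj_on_le[of ?key])
    show "inj_on ?key (cube_homs d V R (even_subsets {..<d}))"
    proof (intro inj_onI ext)
      fix f g A assume f: "f \<in> cube_homs d V R (even_subsets {..<d})"
        and g: "g \<in> cube_homs d V R (even_subsets {..<d})" and eq: "?key f = ?key g"
      have e: "{} \<in> even_subsets {..<d}" by (simp add: even_subsets_def)
      consider "\<not> A \<subseteq> {..<d}" | "A \<in> ?O" | "A \<in> even_subsets {..<d}" by (auto simp: even_subsets_def)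
      then show "f A = g A"
      proof cases
        case 1
        then show ?thesis using cube_homsD(2)[OF f 1] cube_homsD(2)[OF g 1] by simp
      next
        case 2
        then show ?thesis using fun_cong[OF conjunct2[OF eq[unfolded prod.inject]], of A] by simp
      next
        case 3
        then show ?thesis
          using cube_homsD(4)[OF f 3 e] cube_homsD(4)[OF g 3 e] conjunct1[OF eq[unfolded prod.inject]] by simp
      qed
    qed
    show "?key ` cube_homs d V R (even_subsets {..<d}) \<subseteq> ?T"
    proof (rule image_subsetI)
      fix f assume f: "f \<in> cube_homs d V R (even_subsets {..<d})"
      have "f A \<in> V \<and> R (f {}) (f A)" if A: "A \<subseteq> {..<d}" "odd (card A)" for A
      proof -
        \<comment> \<open>An odd set is nonempty, so it has a neighbour in the even half, where
          \<open>f\<close> takes the value at the centre.\<close>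
        obtain k where k: "k \<in> A" using A(2) by fastforce
        have "A - {k} \<in> even_subsets {..<d}" "{} \<in> even_subsets {..<d}"
          using A k by (auto simp: even_subsets_def card_Diff_singleton)
        then have "f (A - {k}) = f {}" by (rule cube_homsD(4)[OF f])
        moreover have "sym_diff (A - {k}) A = {k}" using k by blast
        then have "cube_adj (A - {k}) A" by (simp add: cube_adj_def)
        ultimately show ?thesis using cube_homsD(3)[OF f, of "A - {k}" A] cube_homsD(1)[OF f A(1)] A(1) by auto
      qed
      then show "?key f \<in> ?T" using cube_homsD(1)[OF f, of "{}"] by auto
    qed
  qed (rule finT)
  also have "\<dots> = (\<Sum>v\<in>V. card {u \<in> V. R v u} ^ (2 ^ (d - 1)))"
    using V fin by (simp add: finite_PiE card_PiE card_odd_subsets[OF d])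
  also have "\<dots> \<le> (\<Sum>v\<in>V. D ^ (2 ^ (d - 1)))"
    by (intro sum_mono power_mono D) auto
  finally show ?thesis by simp
qed

text \<open>By pigeonhole one pair has the share 4^(-d) of all homomorphisms. In the
  \<open>q\<close>-th power of this estimate all but one factor \<open>?h {}\<close> cancel.\<close>

lemma card_cube_homs_le:
  assumes V: "finite V" and irr: "\<And>v. v \<in> V \<Longrightarrow> \<not> R v v" and d: "d \<ge> 1"
    and D: "\<And>v. v \<in> V \<Longrightarrow> card {u \<in> V. R v u} \<le> D"
    and free: "\<And>f. f \<in> cube_homs d V R {} \<Longrightarrow> \<not> inj_on f (Pow {..<d})"
  shows "card (cube_homs d V R {}) \<le> (4 ^ d) ^ (4 ^ (d - 2)) * (card V * D ^ (2 ^ (d - 1)))"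
proof (cases "card (cube_homs d V R {}) = 0")
  case False
  let ?h = "\<lambda>S. card (cube_homs d V R S)"
  define q :: nat where "q = 4 ^ (d - 2)"
  define P where "P = {(x, y) \<in> Pow {..<d} \<times> Pow {..<d}. x \<noteq> y}"
  have finP: "finite P" by (rule finite_subset[of _ "Pow {..<d} \<times> Pow {..<d}"]) (auto simp: P_def)
  have "card P \<le> card (Pow {..<d} \<times> Pow {..<d})"
    by (rule card_mono) (auto simp: P_def)
  then have cP: "card P \<le> 4 ^ d"
    by (simp add: card_Pow card_cartesian_product flip: power_mult_distrib)
  have "cube_homs d V R {} \<subseteq> (\<Union>(x, y)\<in>P. cube_homs d V R {x, y})"
  proof
    fix f assume f: "f \<in> cube_homs d V R {}"
    obtain x y where xy: "x \<subseteq> {..<d}" "y \<subseteq> {..<d}" "x \<noteq> y" "f x = f y"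
      using free[OF f] by (auto simp: inj_on_def)
    then have "f \<in> cube_homs d V R {x, y}" using f unfolding cube_homs_def by fastforce
    then show "f \<in> (\<Union>(x, y)\<in>P. cube_homs d V R {x, y})" using xy by (auto simp: P_def)
  qed
  then have "?h {} \<le> card (\<Union>(x, y)\<in>P. cube_homs d V R {x, y})"
    using V finP by (intro card_mono) auto
  also have "\<dots> \<le> (\<Sum>p\<in>P. card (case p of (x, y) \<Rightarrow> cube_homs d V R {x, y}))"
    by (rule card_UN_le[OF finP])
  finally have sum: "?h {} \<le> (\<Sum>(x, y)\<in>P. ?h {x, y})" by (simp add: case_prod_unfold)
  have "\<exists>(x, y)\<in>P. ?h {} \<le> 4 ^ d * ?h {x, y}"
  proof (rule ccontr)
    assume "\<not> (\<exists>(x, y)\<in>P. ?h {} \<le> 4 ^ d * ?h {x, y})"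
    \<comment> \<open>Strictness is kept as \<open>- 1\<close>, so that termwise monotonicity
      suffices for the sum.\<close>
    then have "4 ^ d * (\<Sum>(x, y)\<in>P. ?h {x, y}) \<le> (\<Sum>(x, y)\<in>P. ?h {} - 1)"
      unfolding sum_distrib_left by (intro sum_mono) fastforce
    also have "\<dots> = card P * (?h {} - 1)" by (simp add: case_prod_unfold)
    also have "\<dots> \<le> 4 ^ d * (?h {} - 1)" using cP by (rule mult_le_mono1)
    finally have "(\<Sum>(x, y)\<in>P. ?h {x, y}) \<le> ?h {} - 1" by simp
    then show False using sum False by linarith
  qed
  then obtain x y where xy: "x \<subseteq> {..<d}" "y \<subseteq> {..<d}" "x \<noteq> y" "?h {} \<le> 4 ^ d * ?h {x, y}"
    by (auto simp: P_def)
  have "?h {} * ?h {} ^ (q - 1) = ?h {} ^ q"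
    by (simp flip: power_Suc add: q_def)
  also have "\<dots> \<le> (4 ^ d * ?h {x, y}) ^ q" using xy(4) by (rule power_mono) simp
  also have "\<dots> = (4 ^ d) ^ q * ?h {x, y} ^ q" by (rule power_mult_distrib)
  also have "\<dots> \<le> (4 ^ d) ^ q * (?h (even_subsets {..<d}) * ?h {} ^ (q - 1))"
    unfolding q_def by (intro mult_le_mono2 card_cube_homs_pair_power_le[OF V irr] xy)
  finally have "?h {} \<le> (4 ^ d) ^ q * ?h (even_subsets {..<d})"
    using False by simp
  also have "\<dots> \<le> (4 ^ d) ^ q * (card V * D ^ (2 ^ (d - 1)))"
    by (intro mult_le_mono2 card_cube_homs_even_subsets_le[OF V d D])
  finally show ?thesis by (simp add: q_def)
qed simp

section \<open>Bounding the maximum degree\<close>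

lemma ex_densest_subset:
  assumes "finite V" "V \<noteq> {}"
  obtains U where "U \<subseteq> V" "U \<noteq> {}"
    "\<And>W. W \<subseteq> V \<Longrightarrow> W \<noteq> {} \<Longrightarrow>
      real (card (arcs W R)) / real (card W) powr s \<le> real (card (arcs U R)) / real (card U) powr s"
proof -
  let ?f = "\<lambda>W. real (card (arcs W R)) / real (card W) powr s"
  let ?P = "Pow V - {{}}"
  have P: "finite ?P" "V \<in> ?P" using assms by auto
  then have "Max (?f ` ?P) \<in> ?f ` ?P" by (intro Max_in) auto
  then obtain U where U: "Max (?f ` ?P) = ?f U" "U \<in> ?P" by (rule imageE)
  show ?thesis
  proof (rule that)
    fix W assume "W \<subseteq> V" "W \<noteq> {}"
    then show "?f W \<le> ?f U" unfolding U(1) [symmetric] using P by (intro Max_ge) auto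
  qed (use U in auto)
qed

lemma card_arcs_eq_sum:
  assumes "finite U"
  shows "card (arcs U R) = (\<Sum>v\<in>U. card {u \<in> U. R v u})"
proof -
  have "arcs U R = (SIGMA v : U. {u \<in> U. R v u})" by (auto simp: arcs_def)
  then show ?thesis using assms by simp
qed

text \<open>Consecutive blocks of an enumeration. The block with index \<open>card U div k\<close>
  may be incomplete or empty.\<close>

lemma ex_equitable_chunks:
  assumes U: "finite U" and k: "k > 0"
  obtains Y where "\<And>i. Y i \<subseteq> U" "\<And>i. card (Y i) \<le> k" "\<And>u. u \<in> U \<Longrightarrow> \<exists>i \<le> card U div k. u \<in> Y i"
proof -
  obtain g where g: "bij_betw g U {0..<card U}" using ex_bij_betw_finite_nat[OF U] by blast
  define Y where "Y i = {u \<in> U. g u div k = i}" for i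
  have "card (Y i) \<le> card {i * k..<i * k + k}" for i
  proof (rule card_inj_on_le)
    show "inj_on g (Y i)" using g by (auto simp: Y_def bij_betw_def intro: inj_on_subset)
    show "g ` Y i \<subseteq> {i * k..<i * k + k}"
    proof (rule image_subsetI)
      fix u assume "u \<in> Y i"
      then have "i * k + g u mod k = g u" using div_mult_mod_eq[of "g u" k] by (simp add: Y_def)
      then show "g u \<in> {i * k..<i * k + k}" using mod_less_divisor[OF k, of "g u"] by simp
    qed
  qed simp
  then have "card (Y i) \<le> k" for i by simp
  moreover have "\<exists>i \<le> card U div k. u \<in> Y i" if "u \<in> U" for u
  proof -
    have "g u < card U" using g that by (auto simp: bij_betw_def)
    then have "g u div k \<le> card U div k" by (intro div_le_mono) simp
    then show ?thesis using that by (auto simp: Y_def)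
  qed
  moreover have "Y i \<subseteq> U" for i by (auto simp: Y_def)
  ultimately show ?thesis using that by blast
qed

lemma powr_1_256_le:
  assumes "s \<ge> (3/2 :: real)"
  shows "(1 / 256) powr s \<le> 1 / (4096 :: real)"
proof -
  have "(1 / 256 :: real) powr s \<le> (1 / 256) powr (3/2)"
    using assms by (intro powr_mono') auto
  also have "(1 / 256 :: real) powr (3/2) = ((1 / 16) powr 2) powr (3/2)"
    by (simp add: powr_numeral power2_eq_square)
  also have "\<dots> = (1 / 16) powr 3" by (simp only: powr_powr) simp
  also have "\<dots> = 1 / 4096" by (simp add: powr_numeral power3_eq_cube)
  finally show ?thesis .
qed

text \<open>
  At most \<open>m / 1024\<close> vertices lie in \<open>B\<close>. Cut \<open>U\<close> into at most 1025 parts of at most \<open>2 m / 1024\<close>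
  vertices: together with \<open>B\<close> each part has at most \<open>m / 256\<close> vertices, hence by \<open>dens\<close> at most a
  fraction \<open>256 powr -3/2 = 1/4096\<close> of all arcs, and every arc meeting \<open>B\<close> occurs for some part.
\<close>

lemma card_arcs_bounded_degree_ge:
  assumes U: "finite U" and m: "card U \<ge> 1024"
    and s: "s \<ge> 3/2" and e: "real (card (arcs U R)) = c * real (card U) powr s"
    and dens: "\<And>W. W \<subseteq> U \<Longrightarrow> real (card (arcs W R)) \<le> c * real (card W) powr s"
  defines "B \<equiv> {v \<in> U. real (card {u \<in> U. R v u}) > 1024 * real (card (arcs U R)) / real (card U)}"
  shows "real (card (arcs U R)) / 2 \<le> real (card (arcs U (\<lambda>u v. R u v \<and> u \<notin> B \<and> v \<notin> B)))"
proof (cases "card (arcs U R) = 0")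
  case False
  define e where "e = real (card (arcs U R))"
  define m where "m = real (card U)"
  have e0: "e > 0" and m0: "m \<ge> 1024" using False m by (simp_all add: e_def m_def)
  have c0: "c \<ge> 0"
  proof (rule ccontr)
    assume "\<not> c \<ge> 0"
    then have "c * m powr s \<le> 0" by (intro mult_nonpos_nonneg) auto
    then show False using e e0 by (simp add: e_def m_def)
  qed
  have BU: "B \<subseteq> U" by (auto simp: B_def)
  then have finB: "finite B" using U finite_subset by blast
  have "real (card B) * (1024 * e / m) = (\<Sum>v\<in>B. 1024 * e / m)" by simp
  also have "\<dots> \<le> (\<Sum>v\<in>B. real (card {u \<in> U. R v u}))"
    by (intro sum_mono) (auto simp: B_def e_def m_def)
  also have "\<dots> \<le> (\<Sum>v\<in>U. real (card {u \<in> U. R v u}))"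
    using U BU by (intro sum_mono2) auto
  also have "\<dots> = e" using card_arcs_eq_sum[OF U, of R] by (simp add: e_def)
  finally have cB: "real (card B) \<le> m / 1024" using e0 m0 by (simp add: field_simps)
  \<comment> \<open>The added one keeps the number of parts below 1026, and
    \<open>m \<ge> 1024\<close> allows it to be absorbed into a second
    \<open>m / 1024\<close>.\<close>
  define k where "k = card U div 1024 + 1"
  have k0: "k > 0" by (simp add: k_def)
  have k1: "real k \<le> 2 * m / 1024"
  proof -
    have "real (card U div 1024) \<le> m / 1024" unfolding m_def using of_nat_div_le_of_nat[of "card U" 1024, where 'a=real] by simp
    then show ?thesis using m0 by (simp add: k_def)
  qed
  have k2: "card U div k \<le> 1024"
  proof -
    have "card U < 1024 * k" by (simp add: k_def)
    then have "card U div k < 1024" using k0 by (simp add: div_less_iff_less_mult)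
    then show ?thesis by simp
  qed
  obtain Y where Y: "\<And>i. Y i \<subseteq> U" "\<And>i. card (Y i) \<le> k" "\<And>u. u \<in> U \<Longrightarrow> \<exists>i \<le> card U div k. u \<in> Y i"
    using ex_equitable_chunks[OF U k0] by metis
  have Y3: "\<exists>i \<le> 1024. u \<in> Y i" if "u \<in> U" for u using Y(3)[OF that] k2 le_trans by blast
  have each: "real (card (arcs (B \<union> Y i) R)) \<le> e / 4096" for i
  proof -
    have "card (B \<union> Y i) \<le> card B + card (Y i)" by (rule card_Un_le)
    then have "real (card (B \<union> Y i)) \<le> m * (1 / 256)" using cB k1 Y(2)[of i] m0 by linarith
    then have "real (card (B \<union> Y i)) powr s \<le> (m * (1 / 256)) powr s"
      using s by (intro powr_mono2) auto
    also have "\<dots> = m powr s * (1 / 256) powr s" using m0 by (intro powr_mult)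
    also have "\<dots> \<le> m powr s * (1 / 4096)" by (intro mult_left_mono powr_1_256_le s) simp
    finally have "c * real (card (B \<union> Y i)) powr s \<le> c * (m powr s * (1 / 4096))"
      using c0 by (rule mult_left_mono)
    also have "\<dots> = e / 4096" using e by (simp add: e_def m_def)
    finally show ?thesis using dens[of "B \<union> Y i"] BU Y(1)[of i] by simp
  qed
  let ?R = "\<lambda>u v. R u v \<and> u \<notin> B \<and> v \<notin> B"
  have fin: "finite (arcs (B \<union> Y i) R)" for i
    using finB Y(1)[of i] U finite_subset by (intro finite_arcs) blast
  have "arcs U R \<subseteq> arcs U ?R \<union> (\<Union>i\<le>1024. arcs (B \<union> Y i) R)"
  proof
    fix p assume p: "p \<in> arcs U R"
    obtain u v where uv: "p = (u, v)" by (meson surj_pair)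
    have uvU: "u \<in> U" "v \<in> U" "R u v" using p by (auto simp: uv arcs_def)
    obtain i j where "i \<le> 1024" "j \<le> 1024" "u \<in> Y i" "v \<in> Y j" using Y3 uvU by metis
    then show "p \<in> arcs U ?R \<union> (\<Union>i\<le>1024. arcs (B \<union> Y i) R)"
      using uvU unfolding uv arcs_def by blast
  qed
  then have "card (arcs U R) \<le> card (arcs U ?R \<union> (\<Union>i\<le>1024. arcs (B \<union> Y i) R))"
    using U fin by (intro card_mono) auto
  also have "\<dots> \<le> card (arcs U ?R) + card (\<Union>i\<le>(1024::nat). arcs (B \<union> Y i) R)" by (rule card_Un_le)
  also have "\<dots> \<le> card (arcs U ?R) + (\<Sum>i\<le>(1024::nat). card (arcs (B \<union> Y i) R))"
    by (intro add_left_mono card_UN_le) simp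
  finally have "e \<le> real (card (arcs U ?R)) + (\<Sum>i\<le>(1024::nat). real (card (arcs (B \<union> Y i) R)))"
    unfolding e_def of_nat_sum [symmetric] of_nat_add [symmetric] of_nat_le_iff .
  \<comment> \<open>The 1025 parts together carry at most 1025/4096 of the arcs, which is less than
    one half.\<close>
  also have "(\<Sum>i\<le>(1024::nat). real (card (arcs (B \<union> Y i) R))) \<le> (\<Sum>i\<le>(1024::nat). e / 4096)"
    by (intro sum_mono each)
  finally show ?thesis using e0 by (simp add: e_def)
qed simp

section \<open>Hypercube-free graphs\<close>

definition cube_exponent :: "nat \<Rightarrow> real" where
  "cube_exponent d = 2 - 1 / (real d - 1) + 1 / ((real d - 1) * 2 ^ (d - 1))"

text \<open>The factors pay for halving the arcs, for the pigeonhole share and for degrees up to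
  1024 times the average. The summand 1024 makes the densest subset large.\<close>

definition cube_const :: "nat \<Rightarrow> real" where
  "cube_const d = 2 ^ (d * 2 ^ (d - 1)) * (4 ^ d) ^ (4 ^ (d - 2)) * 1024 ^ (2 ^ (d - 1)) + 1024"

text \<open>The equation behind the exponent: after substituting e = c m^s, the vertex number occurs
  to the same power in both counts.\<close>

lemma cube_exponent_mult:
  assumes "d \<ge> 2"
  shows "cube_exponent d * real ((d - 1) * 2 ^ (d - 1)) + real (2 ^ (d - 1)) = real (2 * (d - 1) * 2 ^ (d - 1) + 1)"
proof -
  have "(2 - 1 / x + 1 / (x * y)) * (x * y) + y = 2 * x * y + 1" if "x \<noteq> 0" "y \<noteq> 0" for x y :: real
    using that by (simp add: field_simps)
  from this[of "real d - 1" "2 ^ (d - 1)"] show ?thesis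
    using assms by (simp add: cube_exponent_def of_nat_diff)
qed

lemma cube_exponent_bounds:
  assumes "d \<ge> 3"
  shows "cube_exponent d \<ge> 3/2" "cube_exponent d \<le> 2"
proof -
  have "1 / (real d - 1) \<le> 1 / 2" using assms by (simp add: field_simps)
  moreover have "1 / ((real d - 1) * 2 ^ (d - 1)) \<ge> 0" using assms by simp
  moreover have "1 / ((real d - 1) * 2 ^ (d - 1)) \<le> 1 / (real d - 1)"
    using assms by (intro divide_left_mono) (auto simp: mult_le_cancel_left1)
  ultimately show "cube_exponent d \<ge> 3/2" "cube_exponent d \<le> 2"
    unfolding cube_exponent_def by linarith+
qed

lemma card_arcs_le_square:
  "finite V \<Longrightarrow> card (arcs V R) \<le> (card V)\<^sup>2"
  using card_mono[of "V \<times> V" "arcs V R"] by (auto simp: arcs_def card_cartesian_product power2_eq_square)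

text \<open>A counterexample passes to its densest subset with a constant \<open>c\<close> that is
  no smaller. There the two counts differ only in powers of \<open>c\<close> and force
  \<open>c ^ ((d - 1) * N) \<le> L\<close>.\<close>

lemma card_arcs_le_if_no_cube:
  fixes V :: "nat set"
  assumes d: "d \<ge> 3" and V: "finite V" "V \<noteq> {}"
    and sym: "\<And>u v. R u v \<Longrightarrow> R v u" and irr: "\<And>v. \<not> R v v"
    and free: "\<And>f. f \<in> cube_homs d V R {} \<Longrightarrow> \<not> inj_on f (Pow {..<d})"
  shows "real (card (arcs V R)) \<le> cube_const d * real (card V) powr cube_exponent d"
proof (rule ccontr)
  define s where "s = cube_exponent d"
  define N :: nat where "N = 2 ^ (d - 1)"
  define L :: real where "L = 2 ^ (d * N) * (4 ^ d) ^ (4 ^ (d - 2)) * 1024 ^ N"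
  have C: "cube_const d = L + 1024" by (simp add: cube_const_def L_def N_def)
  have L0: "L \<ge> 0" by (simp add: L_def)
  have s: "s \<ge> 3/2" "s \<le> 2" using cube_exponent_bounds[OF d] by (simp_all add: s_def)
  assume "\<not> ?thesis"
  then have big: "real (card (arcs V R)) > (L + 1024) * real (card V) powr s" by (simp add: C s_def)
  have n0: "real (card V) > 0" using V by (simp add: card_gt_0_iff)
  obtain U where U: "U \<subseteq> V" "U \<noteq> {}"
    and max: "\<And>W. W \<subseteq> V \<Longrightarrow> W \<noteq> {} \<Longrightarrow>
      real (card (arcs W R)) / real (card W) powr s \<le> real (card (arcs U R)) / real (card U) powr s"
    using ex_densest_subset[OF V, of R s] by metis
  have finU: "finite U" using U V finite_subset by blast
  define e where "e = real (card (arcs U R))"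
  define m where "m = real (card U)"
  define c where "c = e / m powr s"
  have m0: "m > 0" "m \<ge> 1" using U finU by (auto simp: m_def card_gt_0_iff Suc_le_eq)
  have ec: "e = c * m powr s" using m0 by (simp add: c_def)
  have "L + 1024 < real (card (arcs V R)) / real (card V) powr s"
    using big n0 by (simp add: field_simps)
  also have "\<dots> \<le> c" using max[of V] V by (simp add: c_def e_def m_def)
  finally have cL: "c > L + 1024" .
  have e0: "e > 0" using cL L0 m0 by (simp add: ec)
  \<comment> \<open>There are at most \<open>m\<^sup>2\<close> arcs, so
    \<open>c \<le> m powr (2 - s) \<le> m\<close>, and a large \<open>c\<close> forces a large
    \<open>m\<close>.\<close>
  have "real (card (arcs U R)) \<le> real ((card U)\<^sup>2)"
    unfolding of_nat_le_iff by (rule card_arcs_le_square[OF finU])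
  then have "c * m powr s \<le> m powr 2"
    using m0 unfolding ec [symmetric] by (simp add: e_def m_def)
  also have "\<dots> = m powr (2 - s) * m powr s" by (simp flip: powr_add)
  finally have "c \<le> m powr (2 - s)" using m0 by simp
  also have "\<dots> \<le> m powr 1" using s m0 by (intro powr_mono) auto
  finally have "m \<ge> 1024" using cL L0 m0 by simp
  then have m1: "card U \<ge> 1024" by (simp add: m_def)
  define B where "B = {v \<in> U. real (card {u \<in> U. R v u}) > 1024 * real (card (arcs U R)) / real (card U)}"
  \<comment> \<open>Arcs at \<open>B\<close> are deleted but its vertices stay, so both counts refer
    to the same \<open>m\<close>.\<close>
  define R' where "R' u v \<longleftrightarrow> R u v \<and> u \<notin> B \<and> v \<notin> B" for u v
  define e' where "e' = card (arcs U R')"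
  have dens: "real (card (arcs W R)) \<le> c * real (card W) powr s" if "W \<subseteq> U" for W
  proof (cases "W = {}")
    case True
    then show ?thesis by (simp add: arcs_def)
  next
    case False
    then have "real (card W) > 0" using that finU finite_subset by (fastforce simp: card_gt_0_iff)
    then show ?thesis using max[of W] that U False by (simp add: c_def e_def m_def field_simps)
  qed
  have e': "e / 2 \<le> real e'"
    unfolding e_def e'_def R'_def B_def
    by (rule card_arcs_bounded_degree_ge[OF finU m1 s(1)]) (use ec dens in \<open>auto simp: e_def m_def\<close>)
  define D where "D = nat \<lfloor>1024 * e / m\<rfloor>"
  have D: "real D \<le> 1024 * e / m" using e0 m0 by (simp add: D_def)
  have deg: "card {u \<in> U. R' v u} \<le> D" if "v \<in> U" for v
  proof (cases "v \<in> B")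
    case True
    then show ?thesis by (simp add: R'_def)
  next
    case False
    have "card {u \<in> U. R' v u} \<le> card {u \<in> U. R v u}"
      using finU by (intro card_mono) (auto simp: R'_def)
    also have "\<dots> \<le> D"
      using False that unfolding D_def B_def e_def m_def by (simp add: le_nat_floor)
    finally show ?thesis .
  qed
  let ?h = "card (cube_homs d U R' {})"
  have free': "\<not> inj_on f (Pow {..<d})" if "f \<in> cube_homs d U R' {}" for f
  proof (rule free, rule cube_homsI)
    fix A B assume "A \<subseteq> {..<d}" "B \<subseteq> {..<d}" "cube_adj A B"
    then show "R (f A) (f B)" using cube_homsD(3)[OF that] by (simp add: R'_def)
  qed (use cube_homsD(1,2)[OF that] U in auto)
  have irr': "\<not> R' v v" for v using irr by (simp add: R'_def)
  have h: "?h \<le> (4 ^ d) ^ (4 ^ (d - 2)) * (card U * D ^ N)"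
    unfolding N_def
    using d by (intro card_cube_homs_le[OF finU irr' _ deg free']) simp_all
  have *: "e' ^ (Suc (d - 1) * 2 ^ (d - 1)) \<le> card (cube_homs (Suc (d - 1)) U R' {}) * card U ^ ((d - 1) * 2 ^ Suc (d - 1))"
    unfolding e'_def by (rule cube_homs_sidorenko[OF finU]) (auto simp: R'_def sym)
  have "e' ^ (d * N) \<le> ?h * card U ^ (2 * (d - 1) * N)"
  proof -
    have "(d - 1) * 2 ^ Suc (d - 1) = 2 * (d - 1) * N" by (simp add: N_def)
    moreover have "Suc (d - 1) = d" using d by simp
    ultimately show ?thesis using * by (simp only: N_def)
  qed
  also have "\<dots> \<le> (4 ^ d) ^ (4 ^ (d - 2)) * (card U * D ^ N) * card U ^ (2 * (d - 1) * N)"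
    using h by (rule mult_le_mono1)
  finally have "real (e' ^ (d * N)) \<le> real ((4 ^ d) ^ (4 ^ (d - 2)) * (card U * D ^ N) * card U ^ (2 * (d - 1) * N))"
    by (simp only: of_nat_le_iff)
  then have sid: "real e' ^ (d * N) \<le> (4 ^ d) ^ (4 ^ (d - 2)) * (m * real D ^ N) * m ^ (2 * (d - 1) * N)"
    by (simp add: m_def)
  have "(e / 2) ^ (d * N) \<le> real e' ^ (d * N)" using e' e0 by (intro power_mono) auto
  also note sid
  also have "(4 ^ d) ^ (4 ^ (d - 2)) * (m * real D ^ N) * m ^ (2 * (d - 1) * N)
      \<le> (4 ^ d) ^ (4 ^ (d - 2)) * (m * (1024 * e / m) ^ N) * m ^ (2 * (d - 1) * N)"
    using m0 D by (intro mult_right_mono mult_left_mono power_mono) auto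
  also have "\<dots> = (4 ^ d) ^ (4 ^ (d - 2)) * 1024 ^ N * e ^ N / m ^ N * m ^ (2 * (d - 1) * N + 1)"
    by (simp add: power_divide power_mult_distrib)
  finally have "e ^ (d * N) * m ^ N \<le> L * e ^ N * m ^ (2 * (d - 1) * N + 1)"
    using m0 by (simp add: L_def power_divide field_simps)
  \<comment> \<open>The star count contributes \<open>e ^ N\<close>, which cancels and leaves the
    exponent \<open>(d - 1) * N\<close>.\<close>
  moreover have "d * N = (d - 1) * N + N" using d by (cases d) auto
  ultimately have "(e ^ ((d - 1) * N) * m ^ N) * e ^ N \<le> (L * m ^ (2 * (d - 1) * N + 1)) * e ^ N"
    by (simp add: power_add mult_ac)
  then have "e ^ ((d - 1) * N) * m ^ N \<le> L * m ^ (2 * (d - 1) * N + 1)" using e0 by simp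
  also have "e ^ ((d - 1) * N) * m ^ N = c ^ ((d - 1) * N) * m ^ (2 * (d - 1) * N + 1)"
  proof -
    have "(m powr s) ^ ((d - 1) * N) * m ^ N = m powr (s * real ((d - 1) * N) + real N)"
      using m0 by (simp add: powr_add powr_realpow flip: powr_power) (simp add: powr_power mult.commute)
    also have "\<dots> = m powr real (2 * (d - 1) * N + 1)"
      using cube_exponent_mult[of d] d by (simp only: s_def N_def)
    also have "\<dots> = m ^ (2 * (d - 1) * N + 1)" using m0 by (intro powr_realpow)
    finally show ?thesis by (simp add: ec power_mult_distrib mult.assoc)
  qed
  finally have "c ^ ((d - 1) * N) \<le> L" using m0 by simp
  moreover have "c \<le> c ^ ((d - 1) * N)"
    using cL L0 d by (intro self_le_power) (auto simp: N_def)
  ultimately show False using cL by linarith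
qed

text \<open>Passes from 0-1 functions to the set encoding: coordinates where two functions differ
  form the symmetric difference of their supports.\<close>

lemma contains_copy_hypercubeI:
  assumes f: "f \<in> cube_homs d (verts G) (\<lambda>u v. {u, v} \<in> edges G) {}" and inj: "inj_on f (Pow {..<d})"
  shows "contains_copy G (hypercube d)"
proof -
  let ?one = "\<lambda>x. {i \<in> {..<d}. x i = (1 :: nat)}"
  let ?V = "{..<d} \<rightarrow>\<^sub>E {0, 1 :: nat}"
  have sub: "?one x \<in> Pow {..<d}" for x by auto
  have one_eq: "x i = (if i \<in> ?one x then 1 else 0)" if "x \<in> ?V" "i < d" for x i
    using that by (auto simp: PiE_iff)
  have "inj_on ?one ?V"
  proof (rule inj_onI)
    fix x y assume x: "x \<in> ?V" and y: "y \<in> ?V" and eq: "?one x = ?one y"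
    show "x = y"
    proof (rule PiE_ext[OF x y])
      fix i assume "i \<in> {..<d}"
      then have i: "i < d" by simp
      have "x i = (if i \<in> ?one x then 1 else 0)" by (rule one_eq[OF x i])
      also have "\<dots> = y i" unfolding eq by (rule one_eq[OF y i, symmetric])
      finally show "x i = y i" .
    qed
  qed
  moreover have "inj_on f (?one ` ?V)" by (rule inj_on_subset[OF inj]) (use sub in blast)
  ultimately have 1: "inj_on (f \<circ> ?one) ?V" by (rule comp_inj_on)
  have 2: "(f \<circ> ?one) ` ?V \<subseteq> verts G"
    unfolding o_def by (intro image_subsetI cube_homsD(1)[OF f]) auto
  have 3: "(f \<circ> ?one) ` {x, y} \<in> edges G"
    if xy: "x \<in> ?V" "y \<in> ?V" "card {i \<in> {..<d}. x i \<noteq> y i} = 1" for x y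
  proof -
    obtain k where k: "{i \<in> {..<d}. x i \<noteq> y i} = {k}" using xy(3) by (auto simp: card_1_singleton_iff)
    have "i \<in> sym_diff (?one x) (?one y) \<longleftrightarrow> i \<in> {i \<in> {..<d}. x i \<noteq> y i}" for i
    proof (cases "i < d")
      case True
      then have "x i \<in> {0, 1}" "y i \<in> {0, 1}" using PiE_mem[OF xy(1)] PiE_mem[OF xy(2)] by auto
      then show ?thesis by auto
    qed simp
    then have "sym_diff (?one x) (?one y) = {i \<in> {..<d}. x i \<noteq> y i}" by (rule set_eqI)
    then have "cube_adj (?one x) (?one y)" using k by (simp add: cube_adj_def)
    then show ?thesis using cube_homsD(3)[OF f, of "?one x" "?one y"] by auto
  qed
  show ?thesis
    unfolding contains_copy_iff[OF simple_graph_hypercube]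
  proof (intro exI[of _ "f \<circ> ?one"] conjI ballI)
    fix e assume "e \<in> edges (hypercube d)"
    then obtain x y where "e = {x, y}" "x \<in> ?V" "y \<in> ?V" "card {i \<in> {..<d}. x i \<noteq> y i} = 1"
      by (auto simp: hypercube_def Let_def)
    then show "(f \<circ> ?one) ` e \<in> edges G" using 3 by blast
  qed (use 1 2 in \<open>simp_all add: hypercube_def Let_def\<close>)
qed

lemma card_edges_le_card_arcs:
  assumes "simple_graph G" "finite (verts G)"
  shows "card (edges G) \<le> card (arcs (verts G) (\<lambda>u v. {u, v} \<in> edges G))"
proof -
  have "edges G \<subseteq> (\<lambda>(u, v). {u, v}) ` arcs (verts G) (\<lambda>u v. {u, v} \<in> edges G)"
  proof
    fix e assume e: "e \<in> edges G"
    obtain u v where "e = {u, v}" "u \<in> verts G" "v \<in> verts G" using simple_graph_edgeE[OF assms(1) e] by metis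
    then show "e \<in> (\<lambda>(u, v). {u, v}) ` arcs (verts G) (\<lambda>u v. {u, v} \<in> edges G)"
      using e by (auto simp: arcs_def image_iff)
  qed
  then show ?thesis using assms(2) by (meson card_image_le card_mono finite_arcs finite_imageI le_trans)
qed

theorem theorem1p4:
  fixes d :: nat
  assumes "d \<ge> 3"
  shows "\<exists>C>0. \<forall>n>0. real (extremal_number n (hypercube d))
           \<le> C * real n powr (2 - 1 / (real d - 1) + 1 / ((real d - 1) * 2 ^ (d - 1)))"
proof (intro exI[of _ "cube_const d"] conjI allI impI)
  show "cube_const d > 0" unfolding cube_const_def by (intro add_nonneg_pos) auto
  fix n :: nat assume n: "n > 0"
  have "edges (hypercube d) \<noteq> {}" using assms by (intro hypercube_has_edge) simp
  then obtain G :: "nat graph" where G: "simple_graph G" "verts G = {..<n}"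
    "\<not> contains_copy G (hypercube d)" "card (edges G) = extremal_number n (hypercube d)"
    using extremal_number_attained[OF simple_graph_hypercube] by metis
  let ?R = "\<lambda>u v. {u, v} \<in> edges G"
  have "real (card (arcs (verts G) ?R)) \<le> cube_const d * real (card (verts G)) powr cube_exponent d"
  proof (rule card_arcs_le_if_no_cube[OF assms])
    show "\<not> ?R v v" for v using G(1) by (auto simp: simple_graph_def nsets_def)
    show "\<not> inj_on f (Pow {..<d})" if "f \<in> cube_homs d (verts G) ?R {}" for f
      using contains_copy_hypercubeI[OF that] G(3) by blast
  qed (use G(2) n in \<open>auto simp: insert_commute\<close>)
  moreover have "real (card (edges G)) \<le> real (card (arcs (verts G) ?R))"
    using card_edges_le_card_arcs[OF G(1)] G(2) by simp
  ultimately show "real (extremal_number n (hypercube d))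
      \<le> cube_const d * real n powr (2 - 1 / (real d - 1) + 1 / ((real d - 1) * 2 ^ (d - 1)))"
    by (simp add: G cube_exponent_def)
qed

end
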